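(* Let $L$ be a locally finite-dimensional restricted Lie algebra over a field of characteristic $p>0$. If $L$ has a $p$-nil restricted ideal of finite codimension, then the restricted enveloping algebra $u(L)$ is semiperfect.
   Context: For a ring $R$ with unity, $\mathcal{J}(R)$ denotes its Jacobson radical. $R$ is semiperfect if $R/\mathcal{J}(R)$ is Artinian and idempotents of $R/\mathcal{J}(R)$ can be lifted to $R$. For a restricted Lie algebra $L$ with $p$-map $x\mapsto x^{[p]}$, $u(L)$ denotes its restricted enveloping algebra. $L$ is locally finite-dimensional if all of its finitely generated restricted subalgebras are finite-dimensional. An element $x\in L$ is $p$-nilpotent if $x^{[p]^n}=0$ for some $n\geq 1$, where $x^{[p]^n}$ is the $n$-fold iterate of the $p$-map applied to $x$. A subset of $L$ is $p$-nil if each of its elements is $p$-nilpotent. A restricted ideal is a Lie ideal closed under the $p$-map. *)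

theory Defs
  imports
    "HOL-Library.Poly_Mapping"
    "HOL-Computational_Algebra.Polynomial"
    "HOL-Algebra.QuotRing"
    "HOL-Algebra.Algebraic_Closure_Type"
begin

section \<open>Semiperfect rings\<close>

definition left_ideal :: "'a set \<Rightarrow> ('a, 'b) ring_scheme \<Rightarrow> bool" where
  "left_ideal I R \<longleftrightarrow> additive_subgroup I R \<and> (\<forall>a\<in>I. \<forall>x\<in>carrier R. x \<otimes>\<^bsub>R\<^esub> a \<in> I)"

definition right_ideal :: "'a set \<Rightarrow> ('a, 'b) ring_scheme \<Rightarrow> bool" where
  "right_ideal I R \<longleftrightarrow> additive_subgroup I R \<and> (\<forall>a\<in>I. \<forall>x\<in>carrier R. a \<otimes>\<^bsub>R\<^esub> x \<in> I)"

definition maximal_left_ideal :: "'a set \<Rightarrow> ('a, 'b) ring_scheme \<Rightarrow> bool" where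
  "maximal_left_ideal M R \<longleftrightarrow> left_ideal M R \<and> M \<noteq> carrier R \<and>
     (\<forall>J. left_ideal J R \<longrightarrow> M \<subseteq> J \<longrightarrow> J = M \<or> J = carrier R)"

definition jacobson_radical :: "('a, 'b) ring_scheme \<Rightarrow> 'a set" where
  "jacobson_radical R = carrier R \<inter> \<Inter>{M. maximal_left_ideal M R}"

locale artinian_ring = ring +
  assumes left_dcc: "\<lbrakk>\<And>n::nat. left_ideal (I n) R; decseq I\<rbrakk> \<Longrightarrow> \<exists>n. \<forall>m\<ge>n. I m = I n"
    and right_dcc: "\<lbrakk>\<And>n::nat. right_ideal (I n) R; decseq I\<rbrakk> \<Longrightarrow> \<exists>n. \<forall>m\<ge>n. I m = I n"

locale semiperfect_ring = ring +
  assumes artinian: "artinian_ring (R Quot jacobson_radical R)"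
    and idempotents_lift:
      "\<lbrakk>e \<in> carrier (R Quot jacobson_radical R); e \<otimes>\<^bsub>R Quot jacobson_radical R\<^esub> e = e\<rbrakk>
       \<Longrightarrow> \<exists>f\<in>carrier R. f \<otimes> f = f \<and> jacobson_radical R +>\<^bsub>R\<^esub> f = e"

text \<open>The radical is a two-sided ideal, so the quotient above is a quotient ring.\<close>

lemma (in ring) left_idealD:
  assumes "left_ideal I R"
  shows "I \<subseteq> carrier R" "\<zero> \<in> I" "\<And>a b. a \<in> I \<Longrightarrow> b \<in> I \<Longrightarrow> a \<oplus> b \<in> I"
    "\<And>a. a \<in> I \<Longrightarrow> \<ominus> a \<in> I" "\<And>a x. a \<in> I \<Longrightarrow> x \<in> carrier R \<Longrightarrow> x \<otimes> a \<in> I"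
proof -
  interpret additive_subgroup I R
    using assms by (simp add: left_ideal_def)
  show "I \<subseteq> carrier R" "\<zero> \<in> I" "\<And>a b. a \<in> I \<Longrightarrow> b \<in> I \<Longrightarrow> a \<oplus> b \<in> I"
    using a_subset by simp_all
  show "\<And>a. a \<in> I \<Longrightarrow> \<ominus> a \<in> I"
    using subgroup.m_inv_closed[OF a_subgroup] by (simp add: a_inv_def)
  show "\<And>a x. a \<in> I \<Longrightarrow> x \<in> carrier R \<Longrightarrow> x \<otimes> a \<in> I"
    using assms by (simp add: left_ideal_def)
qed

lemma (in ring) left_idealI:
  assumes "I \<subseteq> carrier R" "\<zero> \<in> I" "\<And>a b. a \<in> I \<Longrightarrow> b \<in> I \<Longrightarrow> a \<oplus> b \<in> I"
    "\<And>a x. a \<in> I \<Longrightarrow> x \<in> carrier R \<Longrightarrow> x \<otimes> a \<in> I"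
  shows "left_ideal I R"
proof -
  have "\<ominus> a \<in> I" if "a \<in> I" for a
  proof -
    have "\<ominus> \<one> \<otimes> a \<in> I" using assms(4)[OF that] by blast
    then show ?thesis using that assms(1) l_minus[of \<one> a] by auto
  qed
  then have "subgroup I (add_monoid R)"
    using assms by (intro add.subgroupI) (auto simp: a_inv_def)
  then show ?thesis
    using assms unfolding left_ideal_def by (auto intro: additive_subgroupI)
qed

lemma (in ring) jacobson_radical_ideal: "ideal (jacobson_radical R) R"
proof -
  let ?J = "jacobson_radical R"
  have left: "left_ideal ?J R"
    by (rule left_idealI)
      (auto simp: jacobson_radical_def maximal_left_ideal_def left_idealD(2,3,5))
  have right: "a \<otimes> x \<in> ?J" if a: "a \<in> ?J" and x: "x \<in> carrier R" for a x
  proof -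
    have aR: "a \<in> carrier R" using a by (simp add: jacobson_radical_def)
    have "a \<otimes> x \<in> M" if M: "maximal_left_ideal M R" for M
    proof -
      have lM: "left_ideal M R" using M by (simp add: maximal_left_ideal_def)
      note MD = left_idealD[OF lM]
      define N where "N = {r \<in> carrier R. r \<otimes> x \<in> M}"
      have lN: "left_ideal N R"
        by (rule left_idealI) (auto simp: N_def l_distr m_assoc MD x)
      show ?thesis
      proof (cases "N = carrier R")
        case True then show ?thesis using aR by (auto simp: N_def)
      next
        case False
        have "J = N \<or> J = carrier R" if J: "left_ideal J R" "N \<subseteq> J" for J
        proof (rule disjCI)
          assume nc: "J \<noteq> carrier R"
          note JD = left_idealD[OF J(1)]
          define M' where "M' = {y \<in> carrier R. \<exists>m\<in>M. \<exists>j\<in>J. y = m \<oplus> j \<otimes> x}"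
          have M'I: "m \<oplus> j \<otimes> x \<in> M'" if "m \<in> M" "j \<in> J" for m j
            using that MD(1) JD(1) x unfolding M'_def by blast
          have lM': "left_ideal M' R"
          proof (rule left_idealI)
            show "\<zero> \<in> M'"
              using M'I[OF MD(2) JD(2)] x by simp
            show "y \<oplus> z \<in> M'" if yz: "y \<in> M'" "z \<in> M'" for y z
            proof -
              obtain m j m' j' where *: "m \<in> M" "j \<in> J" "y = m \<oplus> j \<otimes> x"
                "m' \<in> M" "j' \<in> J" "z = m' \<oplus> j' \<otimes> x"
                using yz by (auto simp: M'_def)
              have c: "m \<in> carrier R" "j \<in> carrier R" "m' \<in> carrier R" "j' \<in> carrier R"
                using * MD(1) JD(1) by auto
              have "y \<oplus> z = (m \<oplus> m') \<oplus> (j \<oplus> j') \<otimes> x"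
                using c x * by (simp add: l_distr a_ac)
              then show ?thesis
                using M'I[OF MD(3)[OF *(1,4)] JD(3)[OF *(2,5)]] by simp
            qed
            show "r \<otimes> y \<in> M'" if y: "y \<in> M'" and r: "r \<in> carrier R" for y r
            proof -
              obtain m j where *: "m \<in> M" "j \<in> J" "y = m \<oplus> j \<otimes> x"
                using y by (auto simp: M'_def)
              have c: "m \<in> carrier R" "j \<in> carrier R"
                using * MD(1) JD(1) by auto
              have "r \<otimes> y = (r \<otimes> m) \<oplus> (r \<otimes> j) \<otimes> x"
                using c x r * by (simp add: r_distr m_assoc)
              then show ?thesis
                using M'I[OF MD(5)[OF *(1) r] JD(5)[OF *(2) r]] by simp
            qed
          qed (auto simp: M'_def)
          have MM': "M \<subseteq> M'"
          proof
            fix m assume "m \<in> M"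
            then show "m \<in> M'" using M'I[OF _ JD(2), of m] MD(1) x by auto
          qed
          have "M' = M"
          proof (rule ccontr)
            assume "M' \<noteq> M"
            then have M'c: "M' = carrier R"
              using M lM' MM' by (auto simp: maximal_left_ideal_def)
            have "r \<in> J" if r: "r \<in> carrier R" for r
            proof -
              have "r \<otimes> x \<in> M'" using r x M'c by simp
              then obtain m j where *: "m \<in> M" "j \<in> J" "r \<otimes> x = m \<oplus> j \<otimes> x"
                by (auto simp: M'_def)
              have c: "m \<in> carrier R" "j \<in> carrier R" using * MD(1) JD(1) by auto
              have "(r \<ominus> j) \<otimes> x = (m \<oplus> j \<otimes> x) \<ominus> j \<otimes> x"
                using c r x *(3) by (simp add: minus_eq l_distr l_minus)
              also have "\<dots> = m" using c x by (simp add: minus_eq a_assoc r_neg)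
              finally have "r \<ominus> j \<in> N" using * c r by (simp add: N_def)
              then have "(r \<ominus> j) \<oplus> j \<in> J" using J(2) *(2) JD(3) by blast
              then show ?thesis using r c by (simp add: minus_eq a_assoc l_neg)
            qed
            then show False using nc JD(1) by blast
          qed
          moreover have "j \<otimes> x \<in> M'" if "j \<in> J" for j
            using M'I[OF MD(2) that] JD(1) that x by auto
          ultimately have "J \<subseteq> N" using JD(1) by (auto simp: N_def)
          then show "J = N" using J(2) by blast
        qed
        then have "maximal_left_ideal N R"
          using lN False by (auto simp: maximal_left_ideal_def)
        then show ?thesis using a by (auto simp: jacobson_radical_def N_def)
      qed
    qed
    then show ?thesis using aR x by (auto simp: jacobson_radical_def)
  qed
  show ?thesis
  proof (intro ideal.intro ideal_axioms.intro)
    show "additive_subgroup ?J R"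
      using left by (simp add: left_ideal_def)
  qed (fact ring_axioms left_idealD(5)[OF left] right)+
qed


section \<open>Free associative algebras\<close>

text \<open>The free monoid needs a type of its own: lists are not an instance of
  \<^class>\<open>monoid_add\<close>, which the convolution product on \<open>\<Rightarrow>\<^sub>0\<close> requires. The free associative
  unital \<open>'k\<close>-algebra on the set \<open>'l\<close> is then \<open>('l free_monoid) \<Rightarrow>\<^sub>0 'k\<close>.\<close>

datatype 'a free_monoid = Word (letters: "'a list")

instantiation free_monoid :: (type) monoid_add
begin

definition zero_free_monoid :: "'a free_monoid" where
  "0 = Word []"

definition plus_free_monoid :: "'a free_monoid \<Rightarrow> 'a free_monoid \<Rightarrow> 'a free_monoid" where
  "u + v = Word (letters u @ letters v)"

instance
  by standard (simp_all add: zero_free_monoid_def plus_free_monoid_def)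

end

type_synonym ('l, 'k) free_algebra = "'l free_monoid \<Rightarrow>\<^sub>0 'k"

definition gen :: "'l \<Rightarrow> ('l, 'k::field) free_algebra" where
  "gen x = Poly_Mapping.single (Word [x]) 1"

definition const :: "'k \<Rightarrow> ('l, 'k::field) free_algebra" where
  "const c = Poly_Mapping.single 0 c"

lemma (in ring_1) ring_ring_of_type_algebra: "ring (ring_of_type_algebra :: 'a ring)"
proof -
  have "\<exists>y. x + y = 0" for x :: 'a
    using add.right_inverse by blast
  then show ?thesis
    unfolding ring_of_type_algebra_def using add.right_inverse
    by unfold_locales (auto simp: algebra_simps Units_def)
qed


section \<open>Restricted Lie algebras\<close>

locale lie_algebra = vector_space scale
  for scale :: "'k::field \<Rightarrow> 'l::ab_group_add \<Rightarrow> 'l" +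
  fixes bracket :: "'l \<Rightarrow> 'l \<Rightarrow> 'l"
  assumes bracket_add_left: "bracket (x + y) z = bracket x z + bracket y z"
    and bracket_add_right: "bracket x (y + z) = bracket x y + bracket x z"
    and bracket_scale_left: "bracket (scale c x) y = scale c (bracket x y)"
    and bracket_scale_right: "bracket x (scale c y) = scale c (bracket x y)"
    and bracket_self: "bracket x x = 0"
    and jacobi: "bracket x (bracket y z) + bracket y (bracket z x) + bracket z (bracket x y) = 0"
begin

text \<open>The operator \<open>ad (x X + y)\<close> on \<open>L[X]\<close>, the extension of \<open>L\<close> by the polynomial ring in \<open>X\<close>.\<close>

definition ad_pencil :: "'l \<Rightarrow> 'l \<Rightarrow> 'l poly \<Rightarrow> 'l poly" where
  "ad_pencil x y f = pCons 0 (map_poly (bracket x) f) + map_poly (bracket y) f"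

text \<open>\<open>i s\<^sub>i(x, y)\<close> is the coefficient of \<open>X\<^bsup>i-1\<^esup>\<close> in \<open>ad (x X + y)\<^bsup>p-1\<^esup> (x)\<close>, for \<open>1 \<le> i < p\<close>.\<close>

definition jacobson_s :: "nat \<Rightarrow> 'l \<Rightarrow> 'l \<Rightarrow> 'l" where
  "jacobson_s i x y =
     scale (inverse (of_nat i)) (coeff ((ad_pencil x y ^^ (CHAR('k) - 1)) [:x:]) (i - 1))"

end

locale restricted_lie_algebra = lie_algebra scale bracket
  for scale :: "'k::field \<Rightarrow> 'l::ab_group_add \<Rightarrow> 'l" and bracket +
  fixes pmap :: "'l \<Rightarrow> 'l"
  assumes char_pos: "CHAR('k) > 0"
    and ad_pmap: "bracket (pmap x) y = (bracket x ^^ CHAR('k)) y"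
    and pmap_scale: "pmap (scale c x) = scale (c ^ CHAR('k)) (pmap x)"
    and pmap_add: "pmap (x + y) = pmap x + pmap y + (\<Sum>i\<in>{1..<CHAR('k)}. jacobson_s i x y)"
begin

definition finite_dim :: "'l set \<Rightarrow> bool" where
  "finite_dim V \<longleftrightarrow> (\<exists>B. finite B \<and> span B = V)"

text \<open>The cosets of \<open>B\<close> span the quotient space of \<open>L\<close> by \<open>V\<close>.\<close>

definition finite_codim :: "'l set \<Rightarrow> bool" where
  "finite_codim V \<longleftrightarrow> (\<exists>B. finite B \<and> (\<forall>x. \<exists>b\<in>span B. x - b \<in> V))"

definition restricted_subalgebra :: "'l set \<Rightarrow> bool" where
  "restricted_subalgebra H \<longleftrightarrow>
     subspace H \<and> (\<forall>x\<in>H. \<forall>y\<in>H. bracket x y \<in> H) \<and> (\<forall>x\<in>H. pmap x \<in> H)"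

definition restricted_ideal :: "'l set \<Rightarrow> bool" where
  "restricted_ideal I \<longleftrightarrow>
     subspace I \<and> (\<forall>x\<in>I. \<forall>y. bracket x y \<in> I) \<and> (\<forall>x\<in>I. pmap x \<in> I)"

definition locally_finite_dimensional :: bool where
  "locally_finite_dimensional \<longleftrightarrow> (\<forall>S. finite S \<longrightarrow> finite_dim (restricted_subalgebra hull S))"

definition p_nilpotent :: "'l \<Rightarrow> bool" where
  "p_nilpotent x \<longleftrightarrow> (\<exists>n\<ge>1. (pmap ^^ n) x = 0)"

definition p_nil :: "'l set \<Rightarrow> bool" where
  "p_nil S \<longleftrightarrow> (\<forall>x\<in>S. p_nilpotent x)"

text \<open>The first two families make \<open>gen\<close> linear, so that they present the tensor algebra of \<open>L\<close>
  as a quotient of the free algebra on the underlying set of \<open>L\<close>. An ideal of the free algebra as a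
  ring is a subspace, since it is closed under multiplication by constants.\<close>

definition enveloping_relations :: "('l, 'k) free_algebra set" where
  "enveloping_relations =
     {gen (x + y) - gen x - gen y | x y. True} \<union>
     {gen (scale c x) - const c * gen x | c x. True} \<union>
     {gen x * gen y - gen y * gen x - gen (bracket x y) | x y. True} \<union>
     {gen x ^ CHAR('k) - gen (pmap x) | x. True}"

definition restricted_enveloping_algebra :: "('l, 'k) free_algebra set ring" where
  "restricted_enveloping_algebra =
     ring_of_type_algebra Quot genideal ring_of_type_algebra enveloping_relations"

lemma ring_restricted_enveloping_algebra: "ring restricted_enveloping_algebra"
proof -
  interpret F: ring "ring_of_type_algebra :: ('l, 'k) free_algebra ring"
    by (rule ring_ring_of_type_algebra)
  have "ideal (genideal ring_of_type_algebra enveloping_relations)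
          (ring_of_type_algebra :: ('l, 'k) free_algebra ring)"
    by (rule F.genideal_ideal) (simp add: ring_of_type_algebra_def)
  then show ?thesis
    unfolding restricted_enveloping_algebra_def by (rule ideal.quotient_is_ring)
qed

end

end

theory Submission
  imports Defs
begin

text \<open>Let \<open>I\<close> be the given \<open>p\<close>-nil restricted ideal and \<open>N\<close> the ideal of \<open>u(L)\<close> that it
  generates. Two facts carry the proof: \<open>u(L)/N\<close> is finite-dimensional, and \<open>N\<close> is nil.

  The quotient \<open>u(L)/N\<close> is generated by finitely many elements of \<open>L\<close>. Modulo shorter words the
  letters of a word commute, and in a long word some letter occurs \<open>p\<close> times, so that its \<open>p\<close>-th
  power may be replaced by a single element of \<open>L\<close>. Hence words of bounded length span
  (\<open>free_algebra_finite_dim_mod\<close>).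

  An element \<open>f\<close> of \<open>N\<close> involves only finitely many elements of \<open>L\<close>, and these lie in a
  finite-dimensional restricted subalgebra \<open>H\<close>. The elements of \<open>I \<inter> H\<close> are nilpotent in
  \<open>u(L)\<close>, so by the Engel--Jacobson theorem (\<open>engel_jacobson\<close>) all products of some number \<open>m\<close> of
  them vanish. Since \<open>H\<close> normalises \<open>I \<inter> H\<close>, the factors from \<open>I \<inter> H\<close> in the products that make
  up \<open>f\<^sup>m\<close> can be gathered together, and \<open>f\<^sup>m = 0\<close> (\<open>genideal_p_nil_ideal_nil\<close>).

  The rest is ring theory (\<open>semiperfect_Quot_if_nil_below_artinian\<close>). The nil ideal \<open>N\<close> lies in
  the Jacobson radical, so modulo its radical \<open>u(L)\<close> is an image of a finite-dimensional algebra
  and thus Artinian. The radical of an Artinian ring is nil, so the radical of \<open>u(L)\<close> is nil too,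
  and idempotents lift modulo nil ideals.\<close>

section \<open>The Jacobson radical\<close>

context ring
begin

lemma left_ideal_add_principal:
  assumes M: "left_ideal M R" and a: "a \<in> carrier R"
  shows "left_ideal {m \<oplus> r \<otimes> a | m r. m \<in> M \<and> r \<in> carrier R} R" (is "left_ideal ?S R")
proof (rule left_idealI)
  note MD = left_idealD[OF M]
  have I: "m \<oplus> r \<otimes> a \<in> ?S" if "m \<in> M" "r \<in> carrier R" for m r
    using that by blast
  show "?S \<subseteq> carrier R"
    using MD(1) a by auto
  show "\<zero> \<in> ?S"
    using I[OF MD(2) zero_closed] a by simp
  show "x \<oplus> y \<in> ?S" if xy: "x \<in> ?S" "y \<in> ?S" for x y
  proof -
    obtain m r m' r' where *: "m \<in> M" "r \<in> carrier R" "x = m \<oplus> r \<otimes> a"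
      "m' \<in> M" "r' \<in> carrier R" "y = m' \<oplus> r' \<otimes> a"
      using xy by blast
    have "m \<in> carrier R" "m' \<in> carrier R"
      using * MD(1) by auto
    then have "x \<oplus> y = (m \<oplus> m') \<oplus> (r \<oplus> r') \<otimes> a"
      using * a by (simp add: l_distr a_ac)
    then show ?thesis
      using I[OF MD(3)[OF *(1,4)], of "r \<oplus> r'"] * by simp
  qed
  show "s \<otimes> x \<in> ?S" if x: "x \<in> ?S" and s: "s \<in> carrier R" for x s
  proof -
    obtain m r where *: "m \<in> M" "r \<in> carrier R" "x = m \<oplus> r \<otimes> a"
      using x by blast
    have "m \<in> carrier R" using * MD(1) by auto
    then have "s \<otimes> x = s \<otimes> m \<oplus> (s \<otimes> r) \<otimes> a"
      using * a s by (simp add: r_distr m_assoc)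
    then show ?thesis
      using I[OF MD(5)[OF *(1) s], of "s \<otimes> r"] * s by simp
  qed
qed

lemma left_ideal_eq_carrier:
  assumes "left_ideal M R" "\<one> \<in> M"
  shows "M = carrier R"
proof
  show "carrier R \<subseteq> M"
    using left_idealD(5)[OF assms(1,2)] by fastforce
qed (rule left_idealD(1)[OF assms(1)])

text \<open>The finite geometric series inverts \<open>1 - y\<close>; the induction builds its partial sums
  \<open>z\<close> through \<open>z (1 - y) = 1 - y\<^sup>k\<close>.\<close>

lemma one_minus_nilpotent_left_inverse:
  assumes y: "y \<in> carrier R" and nil: "y [^] (n::nat) = \<zero>"
  shows "\<exists>z\<in>carrier R. z \<otimes> (\<one> \<ominus> y) = \<one>"
proof -
  have "\<exists>z\<in>carrier R. z \<otimes> (\<one> \<ominus> y) = \<one> \<ominus> y [^] k" for k :: nat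
  proof (induction k)
    case 0
    then show ?case
      by (intro bexI[of _ \<zero>]) (use y in \<open>simp_all add: minus_eq r_neg\<close>)
  next
    case (Suc k)
    then obtain z where z: "z \<in> carrier R" "z \<otimes> (\<one> \<ominus> y) = \<one> \<ominus> y [^] k"
      by blast
    have "(\<one> \<oplus> z \<otimes> y) \<otimes> (\<one> \<ominus> y) = (\<one> \<ominus> y) \<oplus> (z \<otimes> (\<one> \<ominus> y)) \<otimes> y"
      using y z(1) by (simp add: minus_eq l_distr r_distr m_assoc l_minus r_minus minus_add a_ac)
    also have "\<dots> = (\<one> \<ominus> y) \<oplus> (y \<ominus> y [^] Suc k)"
      unfolding z(2) using y by (simp add: minus_eq l_distr l_minus)
    also have "\<dots> = \<one> \<ominus> y [^] Suc k"
      using y by (simp add: minus_eq a_assoc r_neg1 del: nat_pow_Suc)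
    finally show ?case
      using y z(1) by blast
  qed
  from this[of n] show ?thesis
    using nil by (simp add: minus_eq)
qed

text \<open>If a maximal left ideal \<open>M\<close> missed some \<open>x\<close> in the nil left ideal, then \<open>M + R x = R\<close>
  would give \<open>1 = m + r x\<close>. Here \<open>r x\<close> is nilpotent, so \<open>m = 1 - r x\<close> has a left inverse and
  \<open>M\<close> would contain \<open>1\<close>.\<close>

lemma nil_left_ideal_subset_jacobson_radical:
  assumes N: "left_ideal N R" and nil: "\<And>y. y \<in> N \<Longrightarrow> \<exists>n::nat. y [^] n = \<zero>"
  shows "N \<subseteq> jacobson_radical R"
proof
  fix x assume x: "x \<in> N"
  note ND = left_idealD[OF N]
  have xR: "x \<in> carrier R" using x ND(1) by blast
  have "x \<in> M" if M: "maximal_left_ideal M R" for M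
  proof (rule ccontr)
    assume nx: "x \<notin> M"
    have lM: "left_ideal M R" using M by (simp add: maximal_left_ideal_def)
    note MD = left_idealD[OF lM]
    let ?S = "{m \<oplus> r \<otimes> x | m r. m \<in> M \<and> r \<in> carrier R}"
    have "M \<subseteq> ?S"
    proof
      fix m assume m: "m \<in> M"
      then have "m = m \<oplus> \<zero> \<otimes> x" using MD(1) xR by auto
      then show "m \<in> ?S" using m zero_closed by blast
    qed
    moreover have "x \<in> ?S"
    proof -
      have "x = \<zero> \<oplus> \<one> \<otimes> x" using xR by simp
      then show ?thesis using MD(2) one_closed by blast
    qed
    moreover have "\<And>J. left_ideal J R \<Longrightarrow> M \<subseteq> J \<Longrightarrow> J = M \<or> J = carrier R"
      using M by (simp add: maximal_left_ideal_def)
    note this[OF left_ideal_add_principal[OF lM xR]]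
    ultimately have "?S = carrier R"
      using nx by blast
    then obtain m r where *: "m \<in> M" "r \<in> carrier R" "\<one> = m \<oplus> r \<otimes> x"
      using one_closed by blast
    have rx: "r \<otimes> x \<in> N" "r \<otimes> x \<in> carrier R" and mR: "m \<in> carrier R"
      using ND(5)[OF x *(2)] ND(1) *(1) MD(1) by auto
    obtain z where z: "z \<in> carrier R" "z \<otimes> (\<one> \<ominus> r \<otimes> x) = \<one>"
      using nil[OF rx(1)] one_minus_nilpotent_left_inverse[OF rx(2)] by blast
    have "\<one> \<ominus> r \<otimes> x = m"
      using *(3) rx(2) mR by (simp add: minus_eq a_assoc r_neg)
    then have "\<one> \<in> M"
      using MD(5)[OF *(1) z(1)] z(2) by simp
    then show False
      using left_ideal_eq_carrier[OF lM] M by (simp add: maximal_left_ideal_def)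
  qed
  then show "x \<in> jacobson_radical R"
    using xR by (auto simp: jacobson_radical_def)
qed

lemma left_ideal_in_maximal_left_ideal:
  assumes I: "left_ideal I R" "\<one> \<notin> I"
  shows "\<exists>M. maximal_left_ideal M R \<and> I \<subseteq> M"
proof -
  let ?A = "{J. left_ideal J R \<and> \<one> \<notin> J \<and> I \<subseteq> J}"
  have "\<exists>M\<in>?A. \<forall>J\<in>?A. M \<subseteq> J \<longrightarrow> J = M"
  proof (rule subset_Zorn_nonempty)
    show "?A \<noteq> {}" using I by blast
    fix C assume C: "C \<noteq> {}" "subset.chain ?A C"
    have CA: "\<And>J. J \<in> C \<Longrightarrow> left_ideal J R \<and> \<one> \<notin> J \<and> I \<subseteq> J"
      using C(2) unfolding subset_chain_def by blast
    have "left_ideal (\<Union>C) R"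
    proof (rule left_idealI)
      show "\<Union>C \<subseteq> carrier R" using CA left_idealD(1) by blast
      show "\<zero> \<in> \<Union>C" using CA left_idealD(2) C(1) by blast
      show "r \<otimes> a \<in> \<Union>C" if "a \<in> \<Union>C" "r \<in> carrier R" for a r
        using that CA left_idealD(5) by blast
      show "a \<oplus> b \<in> \<Union>C" if ab: "a \<in> \<Union>C" "b \<in> \<Union>C" for a b
      proof -
        obtain J J' where J: "J \<in> C" "a \<in> J" "J' \<in> C" "b \<in> J'" using ab by blast
        then have "J \<subseteq> J' \<or> J' \<subseteq> J"
          using C(2) unfolding subset_chain_def by blast
        then show ?thesis
          using J CA left_idealD(3) by (meson UnionI subsetD)
      qed
    qed
    then show "\<Union>C \<in> ?A" using CA C(1) by blast
  qed
  then obtain M where MA: "M \<in> ?A" and maxA: "\<forall>J\<in>?A. M \<subseteq> J \<longrightarrow> J = M"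
    by (rule bexE)
  have M: "left_ideal M R" "\<one> \<notin> M" "I \<subseteq> M"
    using MA by simp_all
  have max: "J = M" if "left_ideal J R" "\<one> \<notin> J" "M \<subseteq> J" for J
  proof -
    have "J \<in> ?A" using that M(3) by auto
    then show ?thesis using maxA that(3) by blast
  qed
  have "maximal_left_ideal M R"
    unfolding maximal_left_ideal_def
  proof (intro conjI allI impI)
    show "M \<noteq> carrier R" using M(2) one_closed by blast
    show "J = M \<or> J = carrier R" if J: "left_ideal J R" "M \<subseteq> J" for J
      using max[OF J(1) _ J(2)] left_ideal_eq_carrier[OF J(1)] by blast
  qed (rule M(1))
  then show ?thesis using M(3) by blast
qed

text \<open>If \<open>1 - a\<close> had no left inverse, then the proper left ideal \<open>R (1 - a)\<close> would lie in a
  maximal one, which would contain \<open>a\<close> as well and hence \<open>1\<close>.\<close>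

lemma jacobson_radical_left_quasi_regular:
  assumes a: "a \<in> jacobson_radical R"
  shows "\<exists>z\<in>carrier R. z \<otimes> (\<one> \<ominus> a) = \<one>"
proof (rule ccontr)
  assume neg: "\<not> ?thesis"
  have aR: "a \<in> carrier R" using a by (simp add: jacobson_radical_def)
  have oR: "\<one> \<ominus> a \<in> carrier R" using aR by simp
  have Z: "left_ideal {\<zero>} R" by (rule left_idealI) auto
  let ?S = "{m \<oplus> r \<otimes> (\<one> \<ominus> a) | m r. m \<in> {\<zero>} \<and> r \<in> carrier R}"
  have lS: "left_ideal ?S R" by (rule left_ideal_add_principal[OF Z oR])
  have "\<one> \<notin> ?S"
  proof
    assume "\<one> \<in> ?S"
    then obtain r where r: "r \<in> carrier R" "\<one> = \<zero> \<oplus> r \<otimes> (\<one> \<ominus> a)" by blast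
    then have "r \<otimes> (\<one> \<ominus> a) = \<one>" using oR by simp
    then show False using neg r(1) by blast
  qed
  then obtain M where M: "maximal_left_ideal M R" "?S \<subseteq> M"
    using left_ideal_in_maximal_left_ideal[OF lS] by blast
  have lM: "left_ideal M R" using M by (simp add: maximal_left_ideal_def)
  have "\<one> \<ominus> a = \<zero> \<oplus> \<one> \<otimes> (\<one> \<ominus> a)" using oR by simp
  then have "\<one> \<ominus> a \<in> M" using M(2) one_closed by blast
  moreover have "a \<in> M" using a M(1) by (auto simp: jacobson_radical_def)
  ultimately have "(\<one> \<ominus> a) \<oplus> a \<in> M" by (rule left_idealD(3)[OF lM])
  moreover have "(\<one> \<ominus> a) \<oplus> a = \<one>" using aR by (simp add: minus_eq a_assoc l_neg)
  ultimately show False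
    using left_ideal_eq_carrier[OF lM] M(1) by (simp add: maximal_left_ideal_def)
qed

end

section \<open>Ideals of a ring given by a type class\<close>

lemma ring_of_type_algebra_simps [simp]:
  "carrier (ring_of_type_algebra :: 'a::ring_1 ring) = UNIV"
  "x \<otimes>\<^bsub>ring_of_type_algebra\<^esub> y = x * y"
  "x \<oplus>\<^bsub>ring_of_type_algebra\<^esub> y = x + y"
  "\<one>\<^bsub>ring_of_type_algebra\<^esub> = (1 :: 'a)"
  "\<zero>\<^bsub>ring_of_type_algebra\<^esub> = (0 :: 'a)"
  by (simp_all add: ring_of_type_algebra_def)

lemma ring_of_type_algebra_a_inv [simp]: "\<ominus>\<^bsub>ring_of_type_algebra\<^esub> x = - (x :: 'a::ring_1)"
proof -
  interpret ring "ring_of_type_algebra :: 'a ring" by (rule ring_ring_of_type_algebra)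
  show ?thesis by (rule minus_equality) simp_all
qed

lemma ring_of_type_algebra_a_minus [simp]:
  "x \<ominus>\<^bsub>ring_of_type_algebra\<^esub> y = x - (y :: 'a::ring_1)"
  by (simp add: a_minus_def)

lemma type_idealD:
  assumes "ideal K (ring_of_type_algebra :: 'a::ring_1 ring)"
  shows "0 \<in> K" "\<And>x y. x \<in> K \<Longrightarrow> y \<in> K \<Longrightarrow> x + y \<in> K" "\<And>x. x \<in> K \<Longrightarrow> - x \<in> K"
    "\<And>x y. x \<in> K \<Longrightarrow> y \<in> K \<Longrightarrow> x - y \<in> K"
    "\<And>r x. x \<in> K \<Longrightarrow> r * x \<in> K" "\<And>r x. x \<in> K \<Longrightarrow> x * r \<in> K"
proof -
  interpret ideal K "ring_of_type_algebra :: 'a ring" by (rule assms)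
  show zero: "0 \<in> K" using additive_subgroup.zero_closed[OF is_additive_subgroup] by simp
  show add: "\<And>x y. x \<in> K \<Longrightarrow> y \<in> K \<Longrightarrow> x + y \<in> K"
    using additive_subgroup.a_closed[OF is_additive_subgroup] by simp
  show left: "\<And>r x. x \<in> K \<Longrightarrow> r * x \<in> K" using I_l_closed by simp
  show inv: "\<And>x. x \<in> K \<Longrightarrow> - x \<in> K" using left by (metis mult_minus1)
  show "\<And>x y. x \<in> K \<Longrightarrow> y \<in> K \<Longrightarrow> x - y \<in> K" using add inv by (metis add_uminus_conv_diff)
  show "\<And>r x. x \<in> K \<Longrightarrow> x * r \<in> K" using I_r_closed by simp
qed

lemma type_left_ideal_iff:
  "left_ideal M (ring_of_type_algebra :: 'a::ring_1 ring) \<longleftrightarrow>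
     0 \<in> M \<and> (\<forall>x\<in>M. \<forall>y\<in>M. x + y \<in> M) \<and> (\<forall>x\<in>M. \<forall>r. r * x \<in> M)"
proof -
  interpret ring "ring_of_type_algebra :: 'a ring" by (rule ring_ring_of_type_algebra)
  show ?thesis (is "?l \<longleftrightarrow> ?r")
  proof
    show ?r if ?l
      using left_idealD(2,3,5)[OF that] by simp
    show ?l if ?r
      by (rule left_idealI) (use that in simp_all)
  qed
qed

lemma type_right_ideal_iff:
  "right_ideal M (ring_of_type_algebra :: 'a::ring_1 ring) \<longleftrightarrow>
     0 \<in> M \<and> (\<forall>x\<in>M. \<forall>y\<in>M. x + y \<in> M) \<and> (\<forall>x\<in>M. \<forall>r. x * r \<in> M)" (is "?l \<longleftrightarrow> ?r")
proof
  interpret ring "ring_of_type_algebra :: 'a ring" by (rule ring_ring_of_type_algebra)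
  show ?r if ?l
  proof -
    show ?r
      using that additive_subgroup.zero_closed[of M "ring_of_type_algebra :: 'a ring"]
        additive_subgroup.a_closed[of M "ring_of_type_algebra :: 'a ring"]
      by (simp add: right_ideal_def)
  qed
  show ?l if r: ?r
  proof -
    have "- x \<in> M" if "x \<in> M" for x
      using r that by (metis mult_minus1_right)
    moreover have "M \<noteq> {}" using r by blast
    ultimately have "subgroup M (add_monoid (ring_of_type_algebra :: 'a ring))"
      using r by (intro add.subgroupI) (simp_all add: a_inv_def[symmetric])
    then show ?l
      using r unfolding right_ideal_def by (simp add: additive_subgroupI)
  qed
qed

lemma type_ideal_iff:
  "ideal K (ring_of_type_algebra :: 'a::ring_1 ring) \<longleftrightarrow>
     0 \<in> K \<and> (\<forall>x\<in>K. \<forall>y\<in>K. x + y \<in> K) \<and> (\<forall>x\<in>K. \<forall>r. r * x \<in> K \<and> x * r \<in> K)"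
  (is "?l \<longleftrightarrow> ?r")
proof
  show ?r if ?l
    using type_idealD[OF that] by simp
  show ?l if r: ?r
  proof (intro ideal.intro ideal_axioms.intro)
    show "additive_subgroup K (ring_of_type_algebra :: 'a ring)"
      using r type_left_ideal_iff[of K] by (simp add: left_ideal_def)
  qed (use r in \<open>simp_all add: ring_ring_of_type_algebra\<close>)
qed

text \<open>The chain conditions of the quotient by \<open>K\<close>, expressed through the one-sided ideals above
  \<open>K\<close>. A chain may even mix left and right ideals: for the algebras below only the underlying
  subspaces matter.\<close>

definition artinian_above :: "'a::ring_1 set \<Rightarrow> bool" where
  "artinian_above K \<longleftrightarrow>
     (\<forall>M. (\<forall>n::nat. (left_ideal (M n) (ring_of_type_algebra :: 'a ring) \<or>
                     right_ideal (M n) (ring_of_type_algebra :: 'a ring)) \<and> K \<subseteq> M n) \<longrightarrow>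
        decseq M \<longrightarrow> (\<exists>n. \<forall>m\<ge>n. M m = M n))"

lemma artinian_aboveD:
  fixes K :: "'a::ring_1 set" and M :: "nat \<Rightarrow> 'a set"
  assumes "artinian_above K"
    and "\<And>n. left_ideal (M n) (ring_of_type_algebra :: 'a ring) \<or>
           right_ideal (M n) (ring_of_type_algebra :: 'a ring)"
    and "\<And>n. K \<subseteq> M n" and "decseq M"
  shows "\<exists>n. \<forall>m\<ge>n. M m = M n"
  using assms(1)[unfolded artinian_above_def, THEN spec, of M] assms(2-) by simp

text \<open>Preimages turn a descending chain of one-sided ideals of the image into one above the kernel,
  and surjectivity recovers the original chain from the preimages.\<close>

lemma artinian_ring_hom_image:
  fixes h :: "'a::ring_1 \<Rightarrow> 'b" and S :: "('b, 'c) ring_scheme"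
  assumes S: "ring S" and h: "h \<in> ring_hom ring_of_type_algebra S"
    and surj: "range h = carrier S"
    and K: "artinian_above K" "\<And>x. x \<in> K \<Longrightarrow> h x = \<zero>\<^bsub>S\<^esub>"
  shows "artinian_ring S"
proof -
  interpret S: ring S by (rule S)
  note hs = ring_hom_add[OF h, simplified] ring_hom_mult[OF h, simplified]
  have hc: "h x \<in> carrier S" for x using surj by blast
  have h0: "h 0 = \<zero>\<^bsub>S\<^esub>"
    using ring_hom_zero[OF h ring_ring_of_type_algebra S] by simp
  have stab: "\<exists>n. \<forall>m\<ge>n. I m = I n"
    if sub: "\<And>n. additive_subgroup (I n) S"
      and ids: "\<And>n. left_ideal (h -` I n) (ring_of_type_algebra :: 'a ring) \<or>
                   right_ideal (h -` I n) (ring_of_type_algebra :: 'a ring)"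
      and dec: "decseq I" for I :: "nat \<Rightarrow> 'b set"
  proof -
    have KI: "K \<subseteq> h -` I n" for n
      using K(2) additive_subgroup.zero_closed[OF sub] by auto
    have dec': "decseq (\<lambda>n. h -` I n)"
      using dec by (auto simp: decseq_def)
    obtain n where n: "\<forall>m\<ge>n. h -` I m = h -` I n"
      using artinian_aboveD[OF K(1) ids KI dec'] by (rule exE)
    have "I m = h ` (h -` I m)" for m
      using additive_subgroup.a_subset[OF sub] surj by auto
    then show ?thesis using n by metis
  qed
  show ?thesis
  proof (intro artinian_ring.intro artinian_ring_axioms.intro S)
    fix I :: "nat \<Rightarrow> 'b set" assume l: "\<And>n. left_ideal (I n) S" and "decseq I"
    note D = S.left_idealD[OF l]
    have "left_ideal (h -` I n) (ring_of_type_algebra :: 'a ring)" for n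
      unfolding type_left_ideal_iff using D by (simp add: h0 hs hc)
    then show "\<exists>n. \<forall>m\<ge>n. I m = I n"
      using stab l \<open>decseq I\<close> by (simp add: left_ideal_def)
  next
    fix I :: "nat \<Rightarrow> 'b set" assume r: "\<And>n. right_ideal (I n) S" and "decseq I"
    have sub: "\<And>n. additive_subgroup (I n) S" using r by (simp add: right_ideal_def)
    have "right_ideal (h -` I n) (ring_of_type_algebra :: 'a ring)" for n
      unfolding type_right_ideal_iff
      using r additive_subgroup.zero_closed[OF sub] additive_subgroup.a_closed[OF sub]
      by (simp add: h0 hs hc right_ideal_def)
    then show "\<exists>n. \<forall>m\<ge>n. I m = I n"
      using stab sub \<open>decseq I\<close> by simp
  qed
qed

section \<open>A criterion for semiperfectness\<close>

lemma power_mult_distrib_commuting: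
  fixes a b :: "'a::monoid_mult"
  assumes "a * b = b * a"
  shows "(a * b) ^ n = a ^ n * b ^ n"
proof (induction n)
  case (Suc n)
  have "b * a ^ n = a ^ n * b"
    using power_commuting_commutes[of b a n] assms by (metis power_commuting_commutes)
  then show ?case
    using Suc by (simp add: mult.assoc) (metis mult.assoc)
qed simp

text \<open>Newton's iteration \<open>x \<mapsto> 3 x\<^sup>2 - 2 x\<^sup>3\<close>. With \<open>d = x\<^sup>2 - x\<close> the iterate is
  \<open>y = x + d (1 - 2 x)\<close>, hence congruent to \<open>x\<close> modulo \<open>J\<close>, and
  \<open>y\<^sup>2 - y = d\<^sup>2 (4 d - 3)\<close>. So each step halves the exponent that annihilates the defect of
  idempotency.\<close>

lemma lift_idempotent_modulo_nil:
  fixes K J :: "'a::ring_1 set"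
  assumes K: "ideal K (ring_of_type_algebra :: 'a ring)"
    and J: "ideal J (ring_of_type_algebra :: 'a ring)"
    and "x * x - x \<in> J" "(x * x - x) ^ (2 ^ k) \<in> K"
  shows "\<exists>f. f * f - f \<in> K \<and> f - x \<in> J"
  using assms(3,4)
proof (induction k arbitrary: x)
  case 0
  then show ?case
    using type_idealD(1)[OF J] by (intro exI[of _ x]) simp
next
  case (Suc k)
  define d where "d = x * x - x"
  define y where "y = x + d * (1 - x - x)"
  have c: "d * x = x * d"
    by (simp add: d_def algebra_simps)
  have y: "y * y - y = d\<^sup>2 * (d + d + d + d - 1 - 1 - 1)"
    unfolding y_def d_def power2_eq_square
    by (simp add: algebra_simps)
  have yx: "y - x \<in> J"
    using type_idealD(6)[OF J Suc.prems(1)] by (simp add: y_def d_def)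
  have "y * y - y \<in> J"
    unfolding y power2_eq_square
    using Suc.prems(1) type_idealD(6)[OF J] by (simp add: d_def mult.assoc)
  moreover have "(y * y - y) ^ 2 ^ k \<in> K"
  proof -
    have "d\<^sup>2 * (d + d + d + d - 1 - 1 - 1) = (d + d + d + d - 1 - 1 - 1) * d\<^sup>2"
      using mult_of_nat_commute[of 3 "d * d"] by (simp add: power2_eq_square algebra_simps)
    then have "(y * y - y) ^ 2 ^ k = (d\<^sup>2) ^ 2 ^ k * (d + d + d + d - 1 - 1 - 1) ^ 2 ^ k"
      unfolding y by (rule power_mult_distrib_commuting)
    also have "(d\<^sup>2) ^ 2 ^ k = d ^ 2 ^ Suc k"
      by (simp flip: power_mult)
    finally show ?thesis
      using Suc.prems(2) type_idealD(6)[OF K] by (simp add: d_def)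
  qed
  ultimately obtain f where f: "f * f - f \<in> K" "f - y \<in> J"
    using Suc.IH by blast
  have "f - x = (f - y) + (y - x)" by simp
  then have "f - x \<in> J"
    using type_idealD(2)[OF J f(2) yx] by simp
  then show ?case using f(1) by blast
qed

text \<open>The hypotheses say that the ring modulo \<open>N\<close> is Artinian and that \<open>N\<close> is nil modulo \<open>K\<close>.
  A nil ideal lies in the radical, so the quotient by the radical is an image of an Artinian ring.
  It remains to see that the whole radical is nil, for then idempotents lift by Newton's
  iteration. If \<open>x\<close> lies in the radical, the chain \<open>F x\<^sup>n + N\<close> becomes stationary, so that
  \<open>(1 - b x) x\<^sup>n \<in> N\<close> for some \<open>n\<close> and \<open>b\<close>; as \<open>1 - b x\<close> is left invertible modulo \<open>K\<close>, \<open>x\<^sup>n\<close> lies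
  in the nil ideal \<open>N\<close>.\<close>

theorem semiperfect_Quot_if_nil_below_artinian:
  fixes K N :: "'a::ring_1 set"
  assumes K: "ideal K (ring_of_type_algebra :: 'a ring)"
    and N: "ideal N (ring_of_type_algebra :: 'a ring)" and KN: "K \<subseteq> N"
    and nil: "\<And>x. x \<in> N \<Longrightarrow> \<exists>n. x ^ n \<in> K" and art: "artinian_above N"
  shows "semiperfect_ring ((ring_of_type_algebra :: 'a ring) Quot K)"
proof -
  define F where "F = (ring_of_type_algebra :: 'a ring)"
  define R where "R = F Quot K"
  define \<pi> where "\<pi> = (+>\<^bsub>F\<^esub>) K"
  have FR: "ring F" unfolding F_def by (rule ring_ring_of_type_algebra)
  interpret F: ring F by (rule FR)
  have KF: "ideal K F" using K by (simp add: F_def)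
  have RR: "ring R"
    unfolding R_def by (rule ideal.quotient_is_ring[OF KF])
  interpret R: ring R by (rule RR)
  have hom: "\<pi> \<in> ring_hom F R"
    unfolding \<pi>_def R_def by (rule ideal.rcos_ring_hom[OF KF])
  note hom' = hom[unfolded F_def]
  have \<pi>_eq: "\<pi> x = \<pi> y \<longleftrightarrow> x - y \<in> K" for x y
    using F.quotient_eq_iff_same_a_r_cos[OF KF, of x y] by (simp add: \<pi>_def F_def)
  have \<pi>_range: "range \<pi> = carrier R"
    by (auto simp: \<pi>_def R_def F_def FactRing_def A_RCOSETS_def')
  have \<pi>c [simp]: "\<pi> x \<in> carrier R" for x using \<pi>_range by blast
  have \<pi>_simps: "\<pi> (x + y) = \<pi> x \<oplus>\<^bsub>R\<^esub> \<pi> y" "\<pi> (x * y) = \<pi> x \<otimes>\<^bsub>R\<^esub> \<pi> y"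
    "\<pi> 1 = \<one>\<^bsub>R\<^esub>" "\<pi> 0 = \<zero>\<^bsub>R\<^esub>" for x y
    using ring_hom_add[OF hom'] ring_hom_mult[OF hom'] ring_hom_one[OF hom']
      ring_hom_zero[OF hom' ring_ring_of_type_algebra RR] by simp_all
  have \<pi>_diff: "\<pi> (x - y) = \<pi> x \<ominus>\<^bsub>R\<^esub> \<pi> y" for x y
    using \<pi>_simps(1)[of "x - y" y] by (simp add: R.minus_eq R.a_assoc R.r_neg)
  have \<pi>_pow: "\<pi> (x ^ n) = \<pi> x [^]\<^bsub>R\<^esub> n" for x and n :: nat
    by (induction n) (simp_all add: \<pi>_simps power_Suc2 del: power_Suc)
  have \<pi>_zero: "\<pi> x = \<zero>\<^bsub>R\<^esub> \<longleftrightarrow> x \<in> K" for x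
    using \<pi>_eq[of x 0] by (simp add: \<pi>_simps)

  define rad where "rad = jacobson_radical R"
  have rad: "ideal rad R"
    unfolding rad_def by (rule R.jacobson_radical_ideal)
  \<comment> \<open>Computations with the radical take place in the ambient ring, through its preimage.\<close>
  define J where "J = \<pi> -` rad"
  have J: "ideal J ring_of_type_algebra"
    unfolding type_ideal_iff J_def
    using additive_subgroup.zero_closed[OF ideal.axioms(1)[OF rad]]
      additive_subgroup.a_closed[OF ideal.axioms(1)[OF rad]]
      ideal.I_l_closed[OF rad] ideal.I_r_closed[OF rad]
    by (simp add: \<pi>_simps)

  have NJ: "N \<subseteq> J"
  proof -
    have "left_ideal (\<pi> ` N) R"
    proof (rule R.left_idealI)
      show "\<pi> ` N \<subseteq> carrier R" by auto
      show "\<zero>\<^bsub>R\<^esub> \<in> \<pi> ` N"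
        using type_idealD(1)[OF N] by (metis \<pi>_simps(4) imageI)
      show "a \<oplus>\<^bsub>R\<^esub> b \<in> \<pi> ` N" if "a \<in> \<pi> ` N" "b \<in> \<pi> ` N" for a b
        using that type_idealD(2)[OF N] by (auto simp flip: \<pi>_simps)
      show "r \<otimes>\<^bsub>R\<^esub> a \<in> \<pi> ` N" if "a \<in> \<pi> ` N" "r \<in> carrier R" for a r
        using that type_idealD(5)[OF N] unfolding \<pi>_range[symmetric]
        by (auto simp flip: \<pi>_simps)
    qed
    moreover have "\<exists>n::nat. y [^]\<^bsub>R\<^esub> n = \<zero>\<^bsub>R\<^esub>" if y: "y \<in> \<pi> ` N" for y
    proof -
      obtain x where x: "x \<in> N" "y = \<pi> x" using y by blast
      obtain n where "x ^ n \<in> K" using nil[OF x(1)] by blast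
      then show ?thesis
        using \<pi>_zero[of "x ^ n"] x(2) by (auto simp: \<pi>_pow)
    qed
    ultimately have "\<pi> ` N \<subseteq> rad"
      unfolding rad_def by (rule R.nil_left_ideal_subset_jacobson_radical)
    then show ?thesis by (auto simp: J_def)
  qed

  have J_nil: "\<exists>n. x ^ n \<in> K" if x: "x \<in> J" for x
  proof -
    define M where "M n = {b * x ^ n + k | b k. k \<in> N}" for n
    have MI: "b * x ^ n + k \<in> M n" if "k \<in> N" for b n k
      using that by (auto simp: M_def)
    have lM: "left_ideal (M n) ring_of_type_algebra" for n
      unfolding type_left_ideal_iff
    proof (intro conjI ballI allI)
      show "0 \<in> M n" using MI[OF type_idealD(1)[OF N], of 0 n] by simp
      fix y assume "y \<in> M n"
      then obtain b k where y: "y = b * x ^ n + k" "k \<in> N" by (auto simp: M_def)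
      show "r * y \<in> M n" for r
        using MI[OF type_idealD(5)[OF N y(2)], of "r * b" n r]
        by (simp add: y distrib_left mult.assoc)
      fix z assume "z \<in> M n"
      then obtain b' k' where z: "z = b' * x ^ n + k'" "k' \<in> N" by (auto simp: M_def)
      show "y + z \<in> M n"
        using MI[OF type_idealD(2)[OF N y(2) z(2)], of "b + b'" n]
        by (simp add: y z distrib_right add_ac)
    qed
    have NM: "N \<subseteq> M n" for n
      using MI[of _ 0 n] by auto
    have dec: "decseq M"
    proof (rule decseq_SucI)
      show "M (Suc n) \<subseteq> M n" for n
      proof
        fix y assume "y \<in> M (Suc n)"
        then obtain b k where y: "y = b * x ^ Suc n + k" "k \<in> N" by (auto simp: M_def)
        then show "y \<in> M n" using MI[OF y(2), of "b * x" n] by (simp add: mult.assoc)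
      qed
    qed
    obtain n where "\<forall>m\<ge>n. M m = M n"
      using artinian_aboveD[OF art disjI1[OF lM] NM dec] by (rule exE)
    then have "M (Suc n) = M n" by (rule allE[of _ "Suc n"]) simp
    moreover have "x ^ n \<in> M n"
      using MI[OF type_idealD(1)[OF N], of 1 n] by simp
    ultimately have "x ^ n \<in> M (Suc n)" by (simp only:)
    then obtain b k where bk: "x ^ n = b * x ^ Suc n + k" "k \<in> N"
      by (auto simp: M_def)
    have "b * x \<in> J" by (rule type_idealD(5)[OF J x])
    then obtain w where "w \<in> carrier R" "w \<otimes>\<^bsub>R\<^esub> (\<one>\<^bsub>R\<^esub> \<ominus>\<^bsub>R\<^esub> \<pi> (b * x)) = \<one>\<^bsub>R\<^esub>"
      using R.jacobson_radical_left_quasi_regular[of "\<pi> (b * x)"] by (auto simp: J_def rad_def)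
    moreover from this obtain z where "w = \<pi> z" using \<pi>_range by (metis imageE)
    ultimately have "\<pi> (z * (1 - b * x)) = \<pi> 1"
      by (simp add: \<pi>_simps \<pi>_diff)
    then have "z * (1 - b * x) - 1 \<in> N" using \<pi>_eq KN by blast
    then have "z * k - (z * (1 - b * x) - 1) * x ^ n \<in> N"
      by (rule type_idealD(4)[OF N type_idealD(5)[OF N bk(2)] type_idealD(6)[OF N]])
    also have "z * k - (z * (1 - b * x) - 1) * x ^ n = x ^ n"
    proof -
      have k: "k = x ^ n - b * x * x ^ n"
        by (subst bk(1)) (simp add: mult.assoc)
      show ?thesis by (subst k) (simp add: algebra_simps)
    qed
    finally obtain m where "(x ^ n) ^ m \<in> K" using nil by blast
    then show ?thesis by (metis power_mult)
  qed

  have "semiperfect_ring R"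
  proof (intro semiperfect_ring.intro semiperfect_ring_axioms.intro RR)
    let ?\<rho> = "(+>\<^bsub>R\<^esub>) rad"
    have \<rho>: "?\<rho> \<in> ring_hom R (R Quot rad)"
      by (rule ideal.rcos_ring_hom[OF rad])
    have "?\<rho> \<circ> \<pi> \<in> ring_hom ring_of_type_algebra (R Quot rad)"
      by (rule ring_hom_trans[OF hom' \<rho>])
    moreover have "range (?\<rho> \<circ> \<pi>) = carrier (R Quot rad)"
      unfolding image_comp[symmetric] \<pi>_range by (auto simp: FactRing_def A_RCOSETS_def')
    moreover have "(?\<rho> \<circ> \<pi>) x = \<zero>\<^bsub>R Quot rad\<^esub>" if "x \<in> N" for x
    proof -
      have "\<pi> x \<in> rad" using that NJ by (auto simp: J_def)
      then show ?thesis
        using R.quotient_eq_iff_same_a_r_cos[OF rad, of "\<pi> x" "\<zero>\<^bsub>R\<^esub>"]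
          ring_hom_zero[OF \<rho> RR ideal.quotient_is_ring[OF rad]] by (simp add: R.minus_eq)
    qed
    ultimately show "artinian_ring (R Quot jacobson_radical R)"
      unfolding rad_def[symmetric]
      by (rule artinian_ring_hom_image[OF ideal.quotient_is_ring[OF rad] _ _ art])
    fix e assume e: "e \<in> carrier (R Quot jacobson_radical R)"
      "e \<otimes>\<^bsub>R Quot jacobson_radical R\<^esub> e = e"
    obtain x where x: "e = ?\<rho> (\<pi> x)"
      using e(1) unfolding rad_def[symmetric]
      by (auto simp: FactRing_def A_RCOSETS_def' \<pi>_range[symmetric])
    have \<rho>_eq: "?\<rho> (\<pi> y) = ?\<rho> (\<pi> z) \<longleftrightarrow> y - z \<in> J" for y z
      using R.quotient_eq_iff_same_a_r_cos[OF rad, of "\<pi> y" "\<pi> z"] by (simp add: J_def \<pi>_diff)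
    have "?\<rho> (\<pi> (x * x)) = ?\<rho> (\<pi> x)"
      using e(2) x ring_hom_mult[OF \<rho>, of "\<pi> x" "\<pi> x"] by (simp add: \<pi>_simps rad_def)
    then have xJ: "x * x - x \<in> J" by (simp add: \<rho>_eq)
    then obtain n where n: "(x * x - x) ^ n \<in> K" using J_nil by blast
    \<comment> \<open>Newton's iteration needs an exponent that is a power of two.\<close>
    have "(x * x - x) ^ (2 ^ n) = (x * x - x) ^ n * (x * x - x) ^ (2 ^ n - n)"
      by (simp flip: power_add add: less_imp_le)
    then have "(x * x - x) ^ (2 ^ n) \<in> K"
      using type_idealD(6)[OF K n] by simp
    then obtain f where f: "f * f - f \<in> K" "f - x \<in> J"
      using lift_idempotent_modulo_nil[OF K J xJ] by blast
    show "\<exists>f\<in>carrier R. f \<otimes>\<^bsub>R\<^esub> f = f \<and> jacobson_radical R +>\<^bsub>R\<^esub> f = e"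
    proof (intro bexI conjI)
      show "\<pi> f \<otimes>\<^bsub>R\<^esub> \<pi> f = \<pi> f"
        using \<pi>_eq[of "f * f" f] f(1) by (simp add: \<pi>_simps)
      show "jacobson_radical R +>\<^bsub>R\<^esub> \<pi> f = e"
        using \<rho>_eq[of f x] f(2) x by (simp add: rad_def)
    qed simp
  qed
  then show ?thesis by (simp add: R_def F_def)
qed

section \<open>Chains of subspaces\<close>

context vector_space
begin

text \<open>Every \<open>M n\<close> contains \<open>K\<close>, so it is determined by \<open>M n \<inter> span E\<close>. Let \<open>c\<close> be the largest
  number of independent vectors that is available in all these intersections. At an index \<open>n\<close>
  where no \<open>c + 1\<close> independent vectors remain the chain has to stop: a vector lost later would
  extend an independent set of size \<open>c\<close> inside the later member.\<close>

lemma descending_subspaces_above_stabilise: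
  assumes E: "finite E" and KE: "span (E \<union> K) = UNIV"
    and M: "\<And>n::nat. subspace (M n)" "\<And>n. K \<subseteq> M n" and dec: "decseq M"
  shows "\<exists>n. \<forall>m\<ge>n. M m = M n"
proof -
  define P where "P c n \<longleftrightarrow> (\<exists>S. independent S \<and> S \<subseteq> M n \<inter> span E \<and> card S = c)" for c n
  have bound: "\<forall>c. (\<forall>n. P c n) \<longrightarrow> c \<le> card E"
    using independent_span_bound[OF E] unfolding P_def by (metis le_inf_iff)
  have "\<forall>n. P 0 n"
    unfolding P_def by (intro allI exI[of _ "{}"]) (simp add: independent_empty)
  then obtain c where c: "\<forall>n. P c n" and max: "\<And>d. \<forall>n. P d n \<Longrightarrow> d \<le> c"
    using Nat.ex_has_greatest_nat[of "\<lambda>c. \<forall>n. P c n" 0 "card E"] bound by auto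
  from max[of "Suc c"] obtain n where n: "\<not> P (Suc c) n" by auto
  have "M m = M n" if mn: "n \<le> m" for m
  proof (rule ccontr)
    assume ne: "M m \<noteq> M n"
    have "M m \<subseteq> M n" using dec mn by (simp add: decseq_def)
    then obtain x where x: "x \<in> M n" "x \<notin> M m" using ne by blast
    have "x \<in> span (E \<union> K)" using KE by simp
    then obtain e k where ek: "x = e + k" "e \<in> span E" "k \<in> span K"
      unfolding span_Un by blast
    have k: "k \<in> M i" for i
      using ek(3) span_minimal[OF M(2) M(1)] by blast
    have "e = x - k" using ek(1) by simp
    then have e: "e \<in> M n" "e \<notin> M m"
      using subspace_diff[OF M(1) x(1) k] subspace_add[OF M(1) _ k, of e m] x(2) ek(1) by auto
    obtain S where S: "independent S" "S \<subseteq> M m \<inter> span E" "card S = c"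
      using c P_def by blast
    have "span S \<subseteq> M m"
      using S(2) M(1) by (intro span_minimal) auto
    then have "e \<notin> span S" using e by blast
    moreover have "finite S"
      using independent_span_bound[OF E S(1)] S(2) by blast
    moreover have "e \<notin> S" using S(2) e by blast
    ultimately have "independent (insert e S)" "card (insert e S) = Suc c"
      using S by (auto simp: independent_insertI)
    moreover have "insert e S \<subseteq> M n \<inter> span E"
      using S(2) \<open>M m \<subseteq> M n\<close> e(1) ek(2) by blast
    ultimately show False using n P_def by blast
  qed
  then show ?thesis by blast
qed

text \<open>A member of the family that contains the largest possible number of independent vectors is
  maximal.\<close>

lemma exists_maximal_subspace:
  assumes B: "finite B" and P: "P H0"
    and sub: "\<And>H. P H \<Longrightarrow> subspace H" "\<And>H. P H \<Longrightarrow> H \<subseteq> span B"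
  shows "\<exists>H. P H \<and> (\<forall>H'. P H' \<longrightarrow> H \<subseteq> H' \<longrightarrow> H' = H)"
proof -
  define Q where "Q c \<longleftrightarrow> (\<exists>H S. P H \<and> independent S \<and> S \<subseteq> H \<and> card S = c)" for c
  have "\<forall>c. Q c \<longrightarrow> c \<le> card B"
    using independent_span_bound[OF B] sub(2) unfolding Q_def by (metis subset_trans)
  moreover have "Q 0"
    unfolding Q_def using P by (intro exI[of _ H0] exI[of _ "{}"]) (simp add: independent_empty)
  ultimately obtain c where "Q c" and max: "\<And>d. Q d \<Longrightarrow> d \<le> c"
    using Nat.ex_has_greatest_nat[of Q 0 "card B"] by auto
  then obtain H S where S: "P H" "independent S" "S \<subseteq> H" "card S = c"
    unfolding Q_def by blast
  have "H' = H" if H': "P H'" "H \<subseteq> H'" for H'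
  proof (rule ccontr)
    assume "H' \<noteq> H"
    then obtain x where x: "x \<in> H'" "x \<notin> H" using H'(2) by blast
    have "span S \<subseteq> H" by (rule span_minimal[OF S(3) sub(1)[OF S(1)]])
    then have "independent (insert x S)" using x S(2) by (intro independent_insertI) auto
    moreover have "finite S"
      using independent_span_bound[OF B S(2)] S(1,3) sub(2) by blast
    then have "card (insert x S) = Suc c" using S(3,4) x(2) by (subst card_insert_disjoint) auto
    moreover have "insert x S \<subseteq> H'" using x(1) S(3) H'(2) by blast
    ultimately have "Q (Suc c)" unfolding Q_def using H'(1) by blast
    then show False using max by fastforce
  qed
  then show ?thesis using S(1) by blast
qed

end

section \<open>The free algebra as a vector space\<close>

lemma const_simps:
  "const (c + d) = const c + const d" "const (c * d) = const c * const d"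
  "const 1 = 1" "const 0 = 0"
  by (simp_all add: const_def single_add mult_single flip: single_one)

definition word :: "'l list \<Rightarrow> ('l, 'k::field) free_algebra" where
  "word xs = prod_list (map gen xs)"

lemma word_simps [simp]:
  "word [] = 1" "word (x # xs) = gen x * word xs" "word (xs @ ys) = word xs * word ys"
  by (simp_all add: word_def)

lemma word_eq_single: "word xs = Poly_Mapping.single (Word xs) 1"
  by (induction xs)
    (simp_all add: gen_def mult_single plus_free_monoid_def zero_free_monoid_def flip: single_one)

lemma free_algebra_word_induct [case_names word add]:
  assumes "\<And>c xs. P (const c * word xs)" "\<And>f g. P f \<Longrightarrow> P g \<Longrightarrow> P (f + g)"
  shows "P (f :: ('l, 'k::field) free_algebra)"
proof (induction f rule: update_induct)
  case const
  then show ?case using assms(1)[of 0] by (simp add: const_simps)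
next
  case (update f w c)
  have "const c * word (letters w) = Poly_Mapping.single w c"
    by (simp add: word_eq_single const_def mult_single)
  moreover have "Poly_Mapping.update w c f = f + Poly_Mapping.single w c"
    using update(1)
    by (intro poly_mapping_eqI)
      (auto simp: lookup_update lookup_add lookup_single when_def in_keys_iff)
  ultimately show ?case
    using assms(1)[of c "letters w"] assms(2) update by metis
qed

lemma free_algebra_induct [case_names const gen add mult]:
  assumes "\<And>c. P (const c)" "\<And>x. P (gen x)" "\<And>f g. P f \<Longrightarrow> P g \<Longrightarrow> P (f + g)"
    "\<And>f g. P f \<Longrightarrow> P g \<Longrightarrow> P (f * g)"
  shows "P (f :: ('l, 'k::field) free_algebra)"
proof (induction f rule: free_algebra_word_induct)
  case (word c xs)
  have "P (word xs)" for xs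
    using assms(1)[of 1] assms(2,4) by (induction xs) (simp_all add: const_simps)
  then show ?case using assms(1,4) by blast
qed (rule assms(3))

lemma const_commute: "const c * f = f * const c"
proof (induction f rule: free_algebra_induct)
  case (const d)
  then show ?case by (metis const_simps(2) mult.commute)
next
  case (gen x)
  then show ?case by (simp add: const_def gen_def mult_single)
next
  case (add f g)
  then show ?case by (simp add: algebra_simps)
next
  case (mult f g)
  then show ?case by (metis mult.assoc)
qed

interpretation free_algebra: vector_space "\<lambda>c f. const c * (f :: ('l, 'k::field) free_algebra)"
  by unfold_locales (simp_all add: const_simps algebra_simps)

text \<open>Constants are central, so right ideals are subspaces as well as left ideals.\<close>

lemma free_algebra_subspaceI:
  assumes "0 \<in> M" "\<And>x y. x \<in> M \<Longrightarrow> y \<in> M \<Longrightarrow> x + y \<in> M"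
    and "left_ideal M ring_of_type_algebra \<or> right_ideal M ring_of_type_algebra"
  shows "free_algebra.subspace (M :: ('l, 'k::field) free_algebra set)"
proof (rule free_algebra.subspaceI)
  show "const c * x \<in> M" if "x \<in> M" for c x
    using assms(3) that const_commute[of c x]
    unfolding type_left_ideal_iff type_right_ideal_iff by metis
qed (use assms in auto)

lemma free_algebra_artinian_above:
  fixes K :: "('l, 'k::field) free_algebra set"
  assumes "finite E" "free_algebra.span (E \<union> K) = UNIV"
  shows "artinian_above K"
  unfolding artinian_above_def
proof (intro allI impI)
  fix M :: "nat \<Rightarrow> ('l, 'k) free_algebra set"
  assume *: "\<forall>n. (left_ideal (M n) ring_of_type_algebra \<or>
      right_ideal (M n) ring_of_type_algebra) \<and> K \<subseteq> M n"
    and dec: "decseq M"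
  have "free_algebra.subspace (M n)" for n
    using * by (intro free_algebra_subspaceI) (auto simp: type_left_ideal_iff type_right_ideal_iff)
  then show "\<exists>n. \<forall>m\<ge>n. M m = M n"
    using * dec by (intro free_algebra.descending_subspaces_above_stabilise[OF assms]) simp_all
qed

section \<open>Ideals containing the enveloping relations\<close>

lemma (in lie_algebra) bracket_antisym: "bracket y x = - bracket x y"
proof -
  have "bracket x y + bracket y x = 0"
    using bracket_self[of "x + y"]
    unfolding bracket_add_left bracket_add_right unfolding bracket_self by (simp add: add.commute)
  then show ?thesis by (simp add: eq_neg_iff_add_eq_0 add.commute)
qed

text \<open>Instead of passing to a quotient of the free algebra, all statements about quotients of
  \<open>u(L)\<close> are made in the free algebra modulo an ideal \<open>K\<close> that contains the relations. Two such
  ideals matter: the ideal of relations itself, and the ideal that in addition contains a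
  restricted ideal of \<open>L\<close>.\<close>

locale enveloping_ideal = restricted_lie_algebra scale bracket pmap
  for scale :: "'k::field \<Rightarrow> 'l::ab_group_add \<Rightarrow> 'l" and bracket pmap +
  fixes K :: "('l, 'k) free_algebra set"
  assumes ideal: "ideal K ring_of_type_algebra"
    and relations: "enveloping_relations \<subseteq> K"
begin

lemmas K_zero = type_idealD(1)[OF ideal]
  and K_add = type_idealD(2)[OF ideal]
  and K_diff = type_idealD(4)[OF ideal]
  and K_mult_left = type_idealD(5)[OF ideal]
  and K_mult_right = type_idealD(6)[OF ideal]

lemma gen_add: "gen (x + y) - gen x - gen y \<in> K"
  and gen_scale: "gen (scale c x) - const c * gen x \<in> K"
  and gen_bracket: "gen x * gen y - gen y * gen x - gen (bracket x y) \<in> K"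
  and gen_pmap: "gen x ^ CHAR('k) - gen (pmap x) \<in> K"
  using relations unfolding enveloping_relations_def Un_subset_iff subset_iff mem_Collect_eq
  by (fast elim: conjE)+

lemma gen_scale_add: "gen (scale c x + y) - (const c * gen x + gen y) \<in> K"
  using K_add[OF gen_add[of "scale c x" y] gen_scale[of c x]] by (simp add: algebra_simps)

lemma gen_zero: "gen 0 \<in> K"
  using gen_scale[of 0 0] by (simp add: const_simps)

lemma gen_pmap_funpow: "gen x ^ (CHAR('k) ^ n) - gen ((pmap ^^ n) x) \<in> K"
proof (induction n)
  case (Suc n)
  have pow: "a ^ k - b ^ k \<in> K" if "a - b \<in> K" for a b k
  proof (induction k)
    case (Suc k)
    have "a ^ Suc k - b ^ Suc k = a * (a ^ k - b ^ k) + (a - b) * b ^ k"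
      by (simp add: algebra_simps)
    then show ?case
      using K_add[OF K_mult_left[OF Suc] K_mult_right[OF that]] by simp
  qed (simp add: K_zero)
  have "((gen x ^ CHAR('k) ^ n) ^ CHAR('k) - gen ((pmap ^^ n) x) ^ CHAR('k)) +
     (gen ((pmap ^^ n) x) ^ CHAR('k) - gen (pmap ((pmap ^^ n) x))) \<in> K"
    by (rule K_add[OF pow[OF Suc] gen_pmap])
  then show ?case
    by (simp add: mult.commute flip: power_mult)
qed (simp add: K_zero)

lemma p_nilpotent_gen:
  assumes "p_nilpotent x" shows "\<exists>n. gen x ^ n \<in> K"
proof -
  obtain n where n: "(pmap ^^ n) x = 0" using assms by (auto simp: p_nilpotent_def)
  have "gen x ^ (CHAR('k) ^ n) - gen 0 \<in> K" using gen_pmap_funpow[of x n] n by simp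
  from K_add[OF this gen_zero] show ?thesis by auto
qed

section \<open>Nilpotency in the enveloping algebra\<close>

text \<open>The elements \<open>y\<close> for which \<open>x\<^sub>1 \<dots> x\<^sub>i y\<close> vanishes modulo \<open>K\<close> for all \<open>x\<^sub>1, \<dots>, x\<^sub>i\<close> in
  \<open>N\<close>. These right ideals form an increasing filtration. Working with it replaces the expansion
  of long products: it suffices to record how far a factor moves an element down the filtration.\<close>

primrec killed :: "'l set \<Rightarrow> nat \<Rightarrow> ('l, 'k) free_algebra set" where
  "killed N 0 = K"
| "killed N (Suc i) = {y. \<forall>x\<in>N. gen x * y \<in> killed N i}"

lemma killed_right_ideal:
  "0 \<in> killed N i"
  "y \<in> killed N i \<Longrightarrow> z \<in> killed N i \<Longrightarrow> y + z \<in> killed N i"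
  "y \<in> killed N i \<Longrightarrow> y * r \<in> killed N i"
  by (induction i arbitrary: y z)
    (auto simp: K_zero K_add K_mult_right distrib_left simp flip: mult.assoc)

lemma K_subset_killed: "y \<in> K \<Longrightarrow> y \<in> killed N i"
  by (induction i arbitrary: y) (auto simp: K_mult_left)

lemma killed_mod: "y - z \<in> K \<Longrightarrow> z \<in> killed N i \<Longrightarrow> y \<in> killed N i"
  using killed_right_ideal(2)[OF K_subset_killed[of "y - z" N i]] by fastforce

lemma killed_const: "y \<in> killed N i \<Longrightarrow> const c * y \<in> killed N i"
  by (simp add: const_commute killed_right_ideal(3))

lemma killed_Suc: "y \<in> killed N i \<Longrightarrow> y \<in> killed N (Suc i)"
  by (induction i arbitrary: y) (auto simp: K_mult_left)

text \<open>Moving \<open>x\<close> past elements of \<open>N\<close> costs only commutators in \<open>N\<close>, which count as one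
  element of \<open>N\<close> like the factor that they replace.\<close>

lemma killed_normalised:
  assumes N: "\<And>y. y \<in> N \<Longrightarrow> bracket y x \<in> N" and y: "y \<in> killed N i"
  shows "gen x * y \<in> killed N i"
  using y
proof (induction i arbitrary: y)
  case (Suc i)
  have "gen n * (gen x * y) \<in> killed N i" if n: "n \<in> N" for n
  proof -
    have 1: "gen x * (gen n * y) \<in> killed N i"
      using Suc.IH Suc.prems n by simp
    have 2: "gen (bracket n x) * y \<in> killed N i"
      using Suc.prems N[OF n] by simp
    have "(gen n * gen x - gen x * gen n - gen (bracket n x)) * y \<in> K"
      by (rule K_mult_right[OF gen_bracket])
    then have "gen n * (gen x * y) - (gen x * (gen n * y) + gen (bracket n x) * y) \<in> K"
      by (simp add: algebra_simps)
    then show ?thesis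
      using killed_right_ideal(2)[OF 1 2] by (rule killed_mod)
  qed
  then show ?case by simp
qed (simp add: K_mult_left)

lemma killed_iff_words:
  "y \<in> killed N i \<longleftrightarrow> (\<forall>u\<in>lists N. length u = i \<longrightarrow> word u * y \<in> K)"
proof (induction i arbitrary: y)
  case (Suc i)
  have "y \<in> killed N (Suc i) \<longleftrightarrow>
      (\<forall>x\<in>N. \<forall>u\<in>lists N. length u = i \<longrightarrow> word (u @ [x]) * y \<in> K)"
    by (simp add: Suc mult.assoc)
  also have "\<dots> \<longleftrightarrow> (\<forall>u\<in>lists N. length u = Suc i \<longrightarrow> word u * y \<in> K)"
  proof (intro iffI ballI impI)
    fix u assume *: "\<forall>x\<in>N. \<forall>u\<in>lists N. length u = i \<longrightarrow> word (u @ [x]) * y \<in> K"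
      "u \<in> lists N" "length u = Suc i"
    then obtain v x where "u = v @ [x]" by (metis length_Suc_conv_rev)
    then show "word u * y \<in> K" using * by auto
  next
    fix x u assume "\<forall>u\<in>lists N. length u = Suc i \<longrightarrow> word u * y \<in> K"
      "x \<in> N" "u \<in> lists N" "length u = i"
    then show "word (u @ [x]) * y \<in> K"
      by (auto dest: bspec[of _ _ "u @ [x]"] simp del: word_simps)
  qed
  finally show ?case .
qed simp

text \<open>Since \<open>killed N m\<close> is a right ideal, this says that all products of \<open>m\<close> elements of \<open>N\<close>
  vanish modulo \<open>K\<close>.\<close>

definition nilpotent_gens :: "'l set \<Rightarrow> bool" where
  "nilpotent_gens N \<longleftrightarrow> (\<exists>m. 1 \<in> killed N m)"

text \<open>On \<open>killed H (i + 1)\<close> the factor \<open>c x + h\<close> acts like \<open>c x\<close> modulo \<open>killed H i\<close>. Hence \<open>r\<close>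
  such factors act like a multiple of \<open>x\<^sup>r\<close>, which vanishes, and lead from \<open>killed H (i + 1)\<close> to
  \<open>killed H i\<close>. If \<open>m\<close> factors from \<open>H\<close> always give zero, so do \<open>m r\<close> factors from the
  extension.\<close>

lemma nilpotent_gens_extend:
  assumes H: "nilpotent_gens H" and x: "gen x ^ r \<in> K"
    and norm: "\<And>h. h \<in> H \<Longrightarrow> bracket h x \<in> H"
  shows "nilpotent_gens {scale c x + h | c h. h \<in> H}" (is "nilpotent_gens ?H'")
proof -
  have step: "\<exists>c. word u * y - const c * (gen x ^ length u * y) \<in> killed H i"
    if y: "y \<in> killed H (Suc i)" and u: "u \<in> lists ?H'" for u y i
    using u
  proof (induction u)
    case Nil
    then show ?case by (intro exI[of _ 1]) (simp add: const_simps killed_right_ideal)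
  next
    case (Cons z u)
    then obtain c where c: "word u * y - const c * (gen x ^ length u * y) \<in> killed H i" by auto
    obtain d h where z: "z = scale d x + h" "h \<in> H"
      using Cons.hyps by blast
    have pow: "gen x ^ k * y \<in> killed H (Suc i)" for k
      by (induction k) (use y killed_normalised[OF norm] in \<open>simp_all add: mult.assoc del: killed.simps\<close>)
    define t where "t = const c * (gen x ^ length u * y)"
    define s where "s = word u * y - t"
    have t: "t \<in> killed H (Suc i)" unfolding t_def by (rule killed_const[OF pow])
    have s: "s \<in> killed H i" using c by (simp add: s_def t_def)
    have 1: "gen h * t \<in> killed H i" using t z(2) by simp
    have 2: "gen h * s \<in> killed H i"
      using killed_Suc[OF s] z(2) by simp
    have 3: "const d * (gen x * s) \<in> killed H i"
      by (rule killed_const[OF killed_normalised[OF norm s]])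
    have "(gen z - (const d * gen x + gen h)) * (s + t) \<in> K"
      using gen_scale_add[of d x h] z(1) by (intro K_mult_right) simp
    also have "(gen z - (const d * gen x + gen h)) * (s + t) =
      (word (z # u) * y - const (d * c) * (gen x ^ length (z # u) * y)) -
      (gen h * t + (gen h * s + const d * (gen x * s)))"
    proof -
      have "const d * (gen x * t) = const (d * c) * (gen x ^ length (z # u) * y)"
      proof -
        have "gen x * (const c * w) = const c * (gen x * w)" for w
          by (simp add: const_commute[of c "gen x"] flip: mult.assoc)
        then have "const d * (gen x * t) = const d * (const c * (gen x * (gen x ^ length u * y)))"
          unfolding t_def by (simp only:)
        then show ?thesis
          by (simp only: const_simps(2) list.size power_Suc mult.assoc add_0_right add_Suc_right)
      qed
      moreover have "s + t = word u * y" by (simp add: s_def)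
      ultimately show ?thesis by (simp add: s_def algebra_simps)
    qed
    finally have "word (z # u) * y - const (d * c) * (gen x ^ length (z # u) * y) \<in> killed H i"
      using killed_right_ideal(2)[OF 1 killed_right_ideal(2)[OF 2 3]] by (rule killed_mod)
    then show ?case by (rule exI)
  qed
  have "word u * y \<in> K" if "y \<in> killed H i" "u \<in> lists ?H'" "length u = i * r" for i u y
    using that
  proof (induction i arbitrary: u y)
    case 0
    then show ?case by (simp add: K_mult_left)
  next
    case (Suc i)
    let ?v = "take (i * r) u" and ?w = "drop (i * r) u"
    have v: "?v \<in> lists ?H'" "length ?v = i * r" and w: "?w \<in> lists ?H'" "length ?w = r"
      using Suc.prems by (auto dest: in_set_takeD in_set_dropD)
    obtain c where c: "word ?w * y - const c * (gen x ^ r * y) \<in> killed H i"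
      using step[OF Suc.prems(1) w(1)] w(2) by auto
    have "const c * (gen x ^ r * y) \<in> killed H i"
      by (intro killed_const K_subset_killed K_mult_right x)
    then have "word ?w * y \<in> killed H i"
      using killed_right_ideal(2)[OF c] by fastforce
    from Suc.IH[OF this v] show ?case
      by (metis append_take_drop_id mult.assoc word_simps(3))
  qed
  moreover obtain m where "1 \<in> killed H m" using H by (auto simp: nilpotent_gens_def)
  ultimately have "1 \<in> killed ?H' (m * r)"
    unfolding killed_iff_words[of 1 ?H'] by blast
  then show ?thesis by (auto simp: nilpotent_gens_def)
qed

text \<open>Let \<open>W i\<close> consist of the elements that vanish modulo \<open>K\<close> as soon as \<open>i\<close> factors from \<open>H\<close>
  are multiplied on, distributed over the two sides. If \<open>m\<close> factors from \<open>H\<close> give zero, then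
  \<open>W (2 m)\<close> is everything, because one side receives at least \<open>m\<close> factors. Commutators with
  elements of \<open>H\<close> lead from \<open>W (j + 1)\<close> to \<open>W j\<close>, so an \<open>x \<in> N - H\<close> with \<open>gen x\<close> in the
  lowest possible \<open>W i\<close> normalises \<open>H\<close>. Here \<open>i \<noteq> 0\<close>, because \<open>W 0 = K\<close> and \<open>H\<close> contains all
  \<open>x \<in> N\<close> with \<open>gen x \<in> K\<close>.\<close>

lemma nilpotent_gens_proper_normaliser:
  assumes H: "nilpotent_gens H" "H \<subset> N"
    and ker: "\<And>x. x \<in> N \<Longrightarrow> gen x \<in> K \<Longrightarrow> x \<in> H"
    and N: "\<And>x y. x \<in> N \<Longrightarrow> y \<in> N \<Longrightarrow> bracket x y \<in> N"
  shows "\<exists>x\<in>N - H. \<forall>h\<in>H. bracket h x \<in> H"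
proof -
  obtain m where m: "1 \<in> killed H m" using H(1) by (auto simp: nilpotent_gens_def)
  have word0: "word u \<in> K" if "u \<in> lists H" "length u \<ge> m" for u
  proof -
    have "take m u \<in> lists H" "length (take m u) = m"
      using that by (auto dest: in_set_takeD)
    then have "word (take m u) * 1 \<in> K"
      using m unfolding killed_iff_words by blast
    then show ?thesis
      using K_mult_right[of "word (take m u)" "word (drop m u)"]
      by (simp flip: word_simps(3))
  qed
  define W where "W i = {y. \<forall>u\<in>lists H. \<forall>v\<in>lists H. length u + length v = i \<longrightarrow>
    word u * y * word v \<in> K}" for i
  have "gen x \<in> W (m + m)" for x
  proof -
    have "word u * gen x * word v \<in> K"
      if uv: "u \<in> lists H" "v \<in> lists H" "length u + length v = m + m" for u v
    proof (cases "length u \<ge> m")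
      case True
      then show ?thesis using word0 uv K_mult_right by metis
    next
      case False
      then have "length v \<ge> m" using uv(3) by linarith
      then show ?thesis using word0 uv K_mult_left by metis
    qed
    then show ?thesis by (auto simp: W_def)
  qed
  moreover obtain x0 where x0: "x0 \<in> N - H" using H(2) by blast
  ultimately have "\<exists>i. \<exists>x\<in>N - H. gen x \<in> W i" by blast
  define i where "i = (LEAST i. \<exists>x\<in>N - H. gen x \<in> W i)"
  obtain x where x: "x \<in> N - H" "gen x \<in> W i"
    using LeastI_ex[OF \<open>\<exists>i. \<exists>x\<in>N - H. gen x \<in> W i\<close>] i_def by blast
  have least: "\<not> gen y \<in> W j" if "y \<in> N - H" "j < i" for y j
    using not_less_Least[of j "\<lambda>i. \<exists>x\<in>N - H. gen x \<in> W i"] that i_def by blast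
  have "i \<noteq> 0"
  proof
    assume "i = 0"
    then have "gen x \<in> K" using x(2) by (auto simp: W_def dest: bspec[of _ _ "[]"])
    then show False using ker x(1) by blast
  qed
  then obtain j where j: "i = Suc j" by (metis not0_implies_Suc)
  have "bracket h x \<in> H" if h: "h \<in> H" for h
  proof (rule ccontr)
    assume "bracket h x \<notin> H"
    then have "bracket h x \<in> N - H" using N h x(1) H(2) by blast
    moreover have "gen (bracket h x) \<in> W j"
    proof -
      have "word u * gen (bracket h x) * word v \<in> K"
        if uv: "u \<in> lists H" "v \<in> lists H" "length u + length v = j" for u v
      proof -
        have a: "word (u @ [h]) * gen x * word v \<in> K"
          and b: "word u * gen x * word (h # v) \<in> K"
          using x(2) uv h unfolding W_def j by (auto simp del: word_simps)
        have c: "word u * (gen h * gen x - gen x * gen h - gen (bracket h x)) * word v \<in> K"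
          by (intro K_mult_left K_mult_right gen_bracket)
        show ?thesis
          using K_diff[OF K_diff[OF a b] c] by (simp add: algebra_simps)
      qed
      then show ?thesis by (auto simp: W_def)
    qed
    ultimately show False using least j by blast
  qed
  then show ?thesis using x(1) by blast
qed

text \<open>A form of the Engel--Jacobson theorem on weakly closed sets of nilpotent elements. Among the
  subalgebras of \<open>N\<close> that contain the kernel of \<open>gen\<close> modulo \<open>K\<close> and all of whose sufficiently
  long products vanish, choose a maximal one, \<open>H\<close>. If \<open>H\<close> were proper, some \<open>x\<close> outside it would
  normalise it, and \<open>H + k x\<close> would be a larger such subalgebra.\<close>

theorem engel_jacobson:
  assumes B: "finite B" "N \<subseteq> span B" and N: "subspace N"
    and bracket: "\<And>x y. x \<in> N \<Longrightarrow> y \<in> N \<Longrightarrow> bracket x y \<in> N"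
    and nil: "\<And>x. x \<in> N \<Longrightarrow> \<exists>n. gen x ^ n \<in> K"
  shows "nilpotent_gens N"
proof -
  define P where "P H \<longleftrightarrow> subspace H \<and> H \<subseteq> N \<and> (\<forall>x\<in>H. \<forall>y\<in>H. bracket x y \<in> H) \<and>
    (\<forall>x\<in>N. gen x \<in> K \<longrightarrow> x \<in> H) \<and> nilpotent_gens H" for H
  let ?ker = "{x \<in> N. gen x \<in> K}"
  have "P ?ker"
    unfolding P_def
  proof (intro conjI)
    show "subspace ?ker"
    proof (rule subspaceI)
      show "0 \<in> ?ker" using subspace_0[OF N] gen_zero by simp
      show "x + y \<in> ?ker" if "x \<in> ?ker" "y \<in> ?ker" for x y
        using subspace_add[OF N] that K_add[OF K_add[OF gen_add[of x y], of "gen x"], of "gen y"]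
        by simp
      show "scale c x \<in> ?ker" if "x \<in> ?ker" for c x
        using subspace_scale[OF N] that
          K_add[OF gen_scale[of c x], of "const c * gen x"] K_mult_left[of "gen x" "const c"]
        by simp
    qed
    show "\<forall>x\<in>?ker. \<forall>y\<in>?ker. bracket x y \<in> ?ker"
    proof (intro ballI)
      fix x y assume xy: "x \<in> ?ker" "y \<in> ?ker"
      then have "gen x * gen y - gen y * gen x \<in> K"
        by (intro K_diff K_mult_left) simp_all
      then show "bracket x y \<in> ?ker"
        using K_diff[OF _ gen_bracket[of x y], of "gen x * gen y - gen y * gen x"] xy bracket by simp
    qed
    show "nilpotent_gens ?ker"
      unfolding nilpotent_gens_def by (intro exI[of _ 1]) simp
  qed auto
  moreover have "subspace H" "H \<subseteq> span B" if "P H" for H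
    using that B(2) by (auto simp: P_def)
  ultimately have "\<exists>H. P H \<and> (\<forall>H'. P H' \<longrightarrow> H \<subseteq> H' \<longrightarrow> H' = H)"
    by (rule exists_maximal_subspace[OF B(1)])
  then obtain H where H: "P H" and max: "\<And>H'. P H' \<Longrightarrow> H \<subseteq> H' \<Longrightarrow> H' = H"
    by blast
  have sub: "subspace H" and HN: "H \<subseteq> N" and nH: "nilpotent_gens H"
    and Hbr: "\<And>x y. x \<in> H \<Longrightarrow> y \<in> H \<Longrightarrow> bracket x y \<in> H"
    and kerH: "\<And>x. x \<in> N \<Longrightarrow> gen x \<in> K \<Longrightarrow> x \<in> H"
    using H by (auto simp: P_def)
  have "H = N"
  proof (rule ccontr)
    assume "H \<noteq> N"
    with HN have "H \<subset> N" by blast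
    from nilpotent_gens_proper_normaliser[OF nH this kerH bracket]
    obtain x where x: "x \<in> N - H" and norm: "\<And>h. h \<in> H \<Longrightarrow> bracket h x \<in> H"
      by auto
    let ?H' = "{scale c x + h | c h. h \<in> H}"
    have I: "scale c x + h \<in> ?H'" if "h \<in> H" for c h using that by blast
    have "H \<subseteq> ?H'" using I[of _ 0] by auto
    moreover have "P ?H'"
      unfolding P_def
    proof (intro conjI)
      show "subspace ?H'"
      proof (rule subspaceI)
        show "0 \<in> ?H'" using \<open>H \<subseteq> ?H'\<close> subspace_0[OF sub] by blast
        fix y assume "y \<in> ?H'"
        then obtain c h where y: "y = scale c x + h" "h \<in> H" by blast
        show "scale d y \<in> ?H'" for d
          using I[OF subspace_scale[OF sub y(2)], of "d * c" d]
          by (simp add: y scale_right_distrib)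
        fix z assume "z \<in> ?H'"
        then obtain d h' where z: "z = scale d x + h'" "h' \<in> H" by blast
        show "y + z \<in> ?H'"
          using I[OF subspace_add[OF sub y(2) z(2)], of "c + d"]
          by (simp add: y z scale_left_distrib algebra_simps)
      qed
      show "?H' \<subseteq> N"
        using x HN subspace_add[OF N] subspace_scale[OF N] by blast
      show "\<forall>y\<in>?H'. \<forall>z\<in>?H'. bracket y z \<in> ?H'"
      proof (intro ballI)
        fix y z assume "y \<in> ?H'" "z \<in> ?H'"
        then obtain c h d h' where yz: "y = scale c x + h" "h \<in> H" "z = scale d x + h'" "h' \<in> H"
          by blast
        have "bracket y z = scale d (bracket h x) - scale c (bracket h' x) + bracket h h'"
          using bracket_antisym[of x h']
          by (simp add: yz bracket_add_left bracket_add_right bracket_scale_left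
              bracket_scale_right bracket_self)
        also have "\<dots> \<in> H"
          using yz norm Hbr
          by (intro subspace_add[OF sub] subspace_diff[OF sub] subspace_scale[OF sub]) auto
        finally show "bracket y z \<in> ?H'" using \<open>H \<subseteq> ?H'\<close> by blast
      qed
      show "\<forall>y\<in>N. gen y \<in> K \<longrightarrow> y \<in> ?H'" using kerH \<open>H \<subseteq> ?H'\<close> by blast
      obtain r where "gen x ^ r \<in> K" using nil x by blast
      then show "nilpotent_gens ?H'"
        using norm by (rule nilpotent_gens_extend[OF nH])
    qed
    ultimately have "?H' = H" using max by blast
    moreover have "x \<in> ?H'" using I[OF subspace_0[OF sub], of 1] by simp
    ultimately show False using x by blast
  qed
  then show ?thesis using nH by simp
qed

end

context enveloping_ideal
begin

section \<open>The ideal generated by a p-nil restricted ideal\<close>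

definition preserving :: "'l set \<Rightarrow> ('l, 'k) free_algebra set" where
  "preserving N = {f. \<forall>i. \<forall>y\<in>killed N i. f * y \<in> killed N i}"

definition lowering :: "'l set \<Rightarrow> ('l, 'k) free_algebra set" where
  "lowering N = {f. \<forall>i. \<forall>y\<in>killed N (Suc i). f * y \<in> killed N i}"

text \<open>Only finitely many elements of \<open>L\<close> occur in \<open>f\<close>. Once \<open>H\<close> contains them, they normalise
  \<open>I \<inter> H\<close>.\<close>

lemma eventually_preserving:
  assumes I: "restricted_ideal I"
  shows "\<exists>S. finite S \<and> (\<forall>H. restricted_subalgebra H \<longrightarrow> S \<subseteq> H \<longrightarrow> f \<in> preserving (I \<inter> H))"
proof (induction f rule: free_algebra_induct)
  case (const c)
  show ?case by (intro exI[of _ "{}"]) (simp add: preserving_def killed_const)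
next
  case (gen x)
  have "gen x \<in> preserving (I \<inter> H)" if H: "restricted_subalgebra H" "x \<in> H" for H
  proof -
    have "bracket y x \<in> I \<inter> H" if "y \<in> I \<inter> H" for y
      using that H I by (simp add: restricted_ideal_def restricted_subalgebra_def)
    then show ?thesis
      unfolding preserving_def by (intro CollectI allI ballI killed_normalised)
  qed
  then show ?case by (intro exI[of _ "{x}"]) simp
next
  case (add f g)
  then obtain S T where "finite S" "finite T"
    "\<And>H. restricted_subalgebra H \<Longrightarrow> S \<subseteq> H \<Longrightarrow> f \<in> preserving (I \<inter> H)"
    "\<And>H. restricted_subalgebra H \<Longrightarrow> T \<subseteq> H \<Longrightarrow> g \<in> preserving (I \<inter> H)" by blast
  then show ?case
    by (intro exI[of _ "S \<union> T"]) (simp add: preserving_def distrib_right killed_right_ideal)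
next
  case (mult f g)
  then obtain S T where "finite S" "finite T"
    "\<And>H. restricted_subalgebra H \<Longrightarrow> S \<subseteq> H \<Longrightarrow> f \<in> preserving (I \<inter> H)"
    "\<And>H. restricted_subalgebra H \<Longrightarrow> T \<subseteq> H \<Longrightarrow> g \<in> preserving (I \<inter> H)" by blast
  then show ?case
    by (intro exI[of _ "S \<union> T"]) (simp add: preserving_def mult.assoc)
qed

text \<open>An element of the ideal is a sum of products with at least one factor from \<open>I\<close>, and modulo
  \<open>K\<close> each such factor moves one step down the filtration, while the other factors do not move
  up. Instead of decomposing \<open>f\<close>, the proof checks that the elements with the asserted property
  form an ideal.\<close>

lemma eventually_lowering:
  assumes I: "restricted_ideal I"
    and f: "f \<in> genideal ring_of_type_algebra (K \<union> gen ` I)"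
  shows "\<exists>S. finite S \<and> (\<forall>H. restricted_subalgebra H \<longrightarrow> S \<subseteq> H \<longrightarrow> f \<in> lowering (I \<inter> H))"
proof -
  interpret F: ring "ring_of_type_algebra :: ('l, 'k) free_algebra ring"
    by (rule ring_ring_of_type_algebra)
  define L where "L = {f. \<exists>S. finite S \<and>
    (\<forall>H. restricted_subalgebra H \<longrightarrow> S \<subseteq> H \<longrightarrow> f \<in> lowering (I \<inter> H))}"
  have LI: "g \<in> L" if "finite S"
    "\<And>H. restricted_subalgebra H \<Longrightarrow> S \<subseteq> H \<Longrightarrow> g \<in> lowering (I \<inter> H)" for g S
    using that by (auto simp: L_def)
  have LD: "\<exists>S. finite S \<and> (\<forall>H. restricted_subalgebra H \<longrightarrow> S \<subseteq> H \<longrightarrow> g \<in> lowering (I \<inter> H))"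
    if "g \<in> L" for g using that by (simp add: L_def)
  have KL: "K \<subseteq> L"
    by (rule subsetI, rule LI[of "{}"]) (simp_all add: lowering_def K_mult_right K_subset_killed)
  have "ideal L ring_of_type_algebra"
    unfolding type_ideal_iff
  proof (intro conjI ballI allI)
    show "0 \<in> L" using KL K_zero by blast
    fix g assume "g \<in> L"
    then obtain S where S: "finite S"
      "\<And>H. restricted_subalgebra H \<Longrightarrow> S \<subseteq> H \<Longrightarrow> g \<in> lowering (I \<inter> H)"
      using LD by blast
    show "g + h \<in> L" if h: "h \<in> L" for h
    proof -
      obtain T where "finite T"
        "\<And>H. restricted_subalgebra H \<Longrightarrow> T \<subseteq> H \<Longrightarrow> h \<in> lowering (I \<inter> H)"
        using LD[OF h] by blast
      with S show ?thesis
        by (intro LI[of "S \<union> T"]) (simp_all add: lowering_def distrib_right killed_right_ideal)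
    qed
    fix r
    obtain T where T: "finite T"
      "\<And>H. restricted_subalgebra H \<Longrightarrow> T \<subseteq> H \<Longrightarrow> r \<in> preserving (I \<inter> H)"
      using eventually_preserving[OF I, of r] by blast
    show "r * g \<in> L"
      by (rule LI[of "S \<union> T"])
        (use S T in \<open>simp_all add: lowering_def preserving_def mult.assoc del: killed.simps\<close>)
    show "g * r \<in> L"
      by (rule LI[of "S \<union> T"])
        (use S T in \<open>simp_all add: lowering_def preserving_def mult.assoc del: killed.simps\<close>)
  qed
  moreover have "gen ` I \<subseteq> L"
  proof (rule image_subsetI)
    show "gen x \<in> L" if "x \<in> I" for x
      by (rule LI[of "{x}"]) (use that in \<open>simp_all add: lowering_def\<close>)
  qed
  ultimately have "genideal ring_of_type_algebra (K \<union> gen ` I) \<subseteq> L"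
    using KL by (intro F.genideal_minimal) simp_all
  then show ?thesis using f LD by blast
qed

text \<open>Choose a finite-dimensional \<open>H\<close> that contains all elements of \<open>L\<close> occurring in \<open>f\<close>. By the
  Engel--Jacobson theorem \<open>1\<close> lies in some step \<open>m\<close> of the filtration belonging to \<open>I \<inter> H\<close>, and
  \<open>f\<close> moves one step down, so \<open>f\<^sup>m = f\<^sup>m \<cdot> 1\<close> lies in the bottom step \<open>K\<close>.\<close>

theorem genideal_p_nil_ideal_nil:
  assumes lf: "locally_finite_dimensional"
    and I: "restricted_ideal I" "p_nil I"
    and f: "f \<in> genideal ring_of_type_algebra (K \<union> gen ` I)"
  shows "\<exists>n. f ^ n \<in> K"
proof -
  obtain S where S: "finite S"
    "\<And>H. restricted_subalgebra H \<Longrightarrow> S \<subseteq> H \<Longrightarrow> f \<in> lowering (I \<inter> H)"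
    using eventually_lowering[OF I(1) f] by blast
  define H where "H = restricted_subalgebra hull S"
  have H: "restricted_subalgebra H"
    unfolding H_def
  proof (rule hull_in)
    show "restricted_subalgebra (\<Inter>T)" if "Ball T restricted_subalgebra" for T
      using that subspace_Inter[of T] unfolding restricted_subalgebra_def by blast
  qed
  have fH: "f \<in> lowering (I \<inter> H)"
    by (rule S(2)[OF H]) (simp add: H_def hull_subset)
  obtain B where B: "finite B" "span B = H"
    using lf S(1) unfolding locally_finite_dimensional_def finite_dim_def H_def by blast
  have "nilpotent_gens (I \<inter> H)"
  proof (rule engel_jacobson[OF B(1)])
    show "subspace (I \<inter> H)"
      using I(1) H by (auto simp: restricted_ideal_def restricted_subalgebra_def subspace_inter)
    show "\<exists>n. gen x ^ n \<in> K" if "x \<in> I \<inter> H" for x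
      using p_nilpotent_gen that I(2) by (auto simp: p_nil_def)
  qed (use B I H in \<open>auto simp: restricted_ideal_def restricted_subalgebra_def\<close>)
  then obtain m where m: "1 \<in> killed (I \<inter> H) m" by (auto simp: nilpotent_gens_def)
  have "f ^ n * y \<in> killed (I \<inter> H) i" if "y \<in> killed (I \<inter> H) (i + n)" for n i y
    using that
  proof (induction n arbitrary: y)
    case (Suc n)
    have "f * y \<in> killed (I \<inter> H) (i + n)"
      using fH Suc.prems by (simp add: lowering_def del: killed.simps)
    from Suc.IH[OF this] show ?case by (simp add: power_Suc2 mult.assoc del: power_Suc)
  qed simp
  from this[of 1 0 m] m have "f ^ m \<in> K" by simp
  then show ?thesis by blast
qed

section \<open>Finite-dimensional quotients of the free algebra\<close>

text \<open>The image of this subspace modulo \<open>K\<close> is the \<open>d\<close>-th step of the standard filtration of the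
  quotient algebra by degree in the generators \<open>B\<close>.\<close>

definition filtration :: "'l set \<Rightarrow> nat \<Rightarrow> ('l, 'k) free_algebra set" where
  "filtration B d = free_algebra.span (word ` {u. set u \<subseteq> B \<and> length u \<le> d} \<union> K)"

lemma filtration_K: "f \<in> K \<Longrightarrow> f \<in> filtration B d"
  unfolding filtration_def by (rule free_algebra.span_base) simp

lemma filtration_word: "set u \<subseteq> B \<Longrightarrow> length u \<le> d \<Longrightarrow> word u \<in> filtration B d"
  unfolding filtration_def by (rule free_algebra.span_base) blast

lemma filtration_subspace: "free_algebra.subspace (filtration B d)"
  unfolding filtration_def by (rule free_algebra.subspace_span)

lemmas filtration_add = free_algebra.subspace_add[OF filtration_subspace]
  and filtration_scale = free_algebra.subspace_scale[OF filtration_subspace]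

lemma filtration_minimal:
  assumes "free_algebra.subspace M" "K \<subseteq> M"
    and "\<And>u. set u \<subseteq> B \<Longrightarrow> length u \<le> d \<Longrightarrow> word u \<in> M"
  shows "filtration B d \<subseteq> M"
  unfolding filtration_def using assms by (intro free_algebra.span_minimal) auto

lemma filtration_mono: "d \<le> e \<Longrightarrow> filtration B d \<subseteq> filtration B e"
  by (rule filtration_minimal) (auto simp: filtration_subspace filtration_K filtration_word)

lemma filtration_mult:
  assumes "f \<in> filtration B d" "g \<in> filtration B e"
  shows "f * g \<in> filtration B (d + e)"
proof -
  have words: "word u * g \<in> filtration B (d + e)" if u: "set u \<subseteq> B" "length u \<le> d" for u
  proof -
    have "filtration B e \<subseteq> {g. word u * g \<in> filtration B (d + e)}"
    proof (rule filtration_minimal)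
      show "free_algebra.subspace {g. word u * g \<in> filtration B (d + e)}"
      proof (rule free_algebra.subspaceI)
        show "const c * x \<in> {g. word u * g \<in> filtration B (d + e)}"
          if "x \<in> {g. word u * g \<in> filtration B (d + e)}" for c x
        proof -
          have "word u * (const c * x) = const c * (word u * x)"
            by (simp add: const_commute[of c "word u"] flip: mult.assoc)
          then show ?thesis using that filtration_scale by simp
        qed
      qed (auto simp: filtration_K K_zero distrib_left filtration_add)
      show "K \<subseteq> {g. word u * g \<in> filtration B (d + e)}"
        by (auto simp: filtration_K K_mult_left)
      show "word v \<in> {g. word u * g \<in> filtration B (d + e)}" if "set v \<subseteq> B" "length v \<le> e" for v
        using filtration_word[of "u @ v" B "d + e"] u that by simp
    qed
    then show ?thesis using assms(2) by blast
  qed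
  have "filtration B d \<subseteq> {f. f * g \<in> filtration B (d + e)}"
  proof (rule filtration_minimal)
    show "free_algebra.subspace {f. f * g \<in> filtration B (d + e)}"
      by (rule free_algebra.subspaceI)
        (auto simp: filtration_K K_zero distrib_right filtration_add mult.assoc filtration_scale)
    show "K \<subseteq> {f. f * g \<in> filtration B (d + e)}"
      by (auto simp: filtration_K K_mult_right)
  qed (use words in simp)
  then show ?thesis using assms(1) by blast
qed

context
  fixes B :: "'l set"
  assumes B: "finite B" and spanning: "\<And>x. \<exists>b\<in>span B. gen (x - b) \<in> K"
begin

lemma gen_filtration: "gen x \<in> filtration B 1"
proof -
  have *: "gen b \<in> filtration B 1" if "b \<in> span B" for b
    using that
  proof (induction rule: span_induct_alt)
    case base
    then show ?case by (rule filtration_K[OF gen_zero])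
  next
    case (step c x y)
    have x: "gen x \<in> filtration B 1" using filtration_word[of "[x]" B 1] step(1) by simp
    then have "gen (scale c x + y) - (const c * gen x + gen y) + (const c * gen x + gen y)
        \<in> filtration B 1"
      by (intro filtration_add filtration_scale x step filtration_K gen_scale_add)
    then show ?case by simp
  qed
  obtain b where b: "b \<in> span B" "gen (x - b) \<in> K" using spanning by blast
  have "gen (b + (x - b)) - gen b - gen (x - b) + gen (x - b) + gen b \<in> filtration B 1"
    by (intro filtration_add filtration_K gen_add b(2) *[OF b(1)])
  then show ?thesis by simp
qed

lemma gen_mult_filtration: "f \<in> filtration B d \<Longrightarrow> gen x * f \<in> filtration B (Suc d)"
  using filtration_mult[OF gen_filtration] by simp

lemma word_filtration: "word u \<in> filtration B (length u)"
  by (induction u) (auto simp: gen_mult_filtration intro: filtration_word[of "[]", simplified])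

text \<open>Each transposition of neighbouring letters leaves a word with a bracket in place of two
  letters, which is shorter by one.\<close>

lemma word_move_to_front:
  "word (u @ a # v) - word (a # u @ v) \<in> filtration B (length (u @ v))"
proof (induction u)
  case Nil
  then show ?case by (simp add: filtration_K K_zero)
next
  case (Cons c u)
  have "word ((c # u) @ a # v) - word (a # (c # u) @ v) =
      gen c * (word (u @ a # v) - word (a # u @ v)) +
      ((gen c * gen a - gen a * gen c - gen (bracket c a)) * word (u @ v) +
       gen (bracket c a) * word (u @ v))"
    by (simp add: algebra_simps)
  also have "\<dots> \<in> filtration B (Suc (length (u @ v)))"
    by (intro filtration_add gen_mult_filtration Cons word_filtration
        filtration_K K_mult_right gen_bracket)
  finally show ?case by simp
qed

text \<open>Letters \<open>a\<close> are brought to the front one at a time. Every move costs an error in the step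
  \<open>d\<close> of the filtration, one below the length of \<open>w\<close>.\<close>

lemma word_collect_letter:
  assumes "j \<le> count_list w a" "length w = Suc d"
  shows "\<exists>v. length w = j + length v \<and> word w - gen a ^ j * word v \<in> filtration B d"
  using assms
proof (induction j arbitrary: w d)
  case 0
  then show ?case by (intro exI[of _ w]) (simp add: filtration_K K_zero)
next
  case (Suc j)
  then have "a \<in> set w" using count_list_0_iff[of w a] by auto
  then obtain u v where w: "w = u @ a # v" by (metis split_list)
  have len: "length (u @ v) = d" and count: "j \<le> count_list (u @ v) a"
    using Suc.prems by (simp_all add: w)
  show ?case
  proof (cases d)
    case 0
    then show ?thesis
      using len count by (intro exI[of _ "[]"]) (simp add: w filtration_K K_zero)
  next
    case (Suc e)
    then obtain v' where v': "length (u @ v) = j + length v'"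
      "word (u @ v) - gen a ^ j * word v' \<in> filtration B e"
      using Suc.IH[OF count] len by metis
    have "word w - gen a ^ Suc j * word v' =
        (word (u @ a # v) - word (a # u @ v)) + gen a * (word (u @ v) - gen a ^ j * word v')"
      by (simp add: w algebra_simps)
    also have "\<dots> \<in> filtration B d"
      using gen_mult_filtration[OF v'(2)] word_move_to_front[of u a v] len Suc
      by (intro filtration_add) simp_all
    finally show ?thesis using v'(1) w by (intro exI[of _ v']) simp
  qed
qed

text \<open>A word of length greater than \<open>card B * (p - 1)\<close> contains some letter \<open>a\<close> at least \<open>p\<close>
  times. Collected at the front these letters form \<open>a\<^sup>p\<close>, which is the single letter \<open>a\<^bsup>[p]\<^esup>\<close>,
  and \<open>p \<ge> 2\<close> makes the word shorter.\<close>

lemma filtration_Suc_subset: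
  assumes d: "card B * (CHAR('k) - 1) \<le> d"
  shows "filtration B (Suc d) \<subseteq> filtration B d"
proof (rule filtration_minimal)
  fix w :: "'l list" assume w: "set w \<subseteq> B" "length w \<le> Suc d"
  have p: "CHAR('k) \<ge> 2"
    using char_pos CHAR_not_1[where 'a = 'k] by linarith
  show "word w \<in> filtration B d"
  proof (cases "length w = Suc d")
    case False
    then show ?thesis using w by (intro filtration_word) auto
  next
    case True
    have "\<exists>a\<in>B. CHAR('k) \<le> count_list w a"
    proof (rule ccontr)
      assume "\<not> ?thesis"
      then have "sum (count_list w) B \<le> of_nat (card B) * (CHAR('k) - 1)"
        by (intro sum_bounded_above) fastforce
      then show False
        using sum_count_set[OF w(1) B] d True by simp
    qed
    then obtain a v where v: "length w = CHAR('k) + length v"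
      "word w - gen a ^ CHAR('k) * word v \<in> filtration B d"
      using word_collect_letter True by metis
    have "gen (pmap a) * word v \<in> filtration B d"
      using gen_mult_filtration[OF word_filtration, of "pmap a" v]
        filtration_mono[of "Suc (length v)" d B] v(1) True p by auto
    moreover have "(gen a ^ CHAR('k) - gen (pmap a)) * word v \<in> filtration B d"
      by (intro filtration_K K_mult_right gen_pmap)
    ultimately have "(word w - gen a ^ CHAR('k) * word v) +
      ((gen a ^ CHAR('k) - gen (pmap a)) * word v + gen (pmap a) * word v) \<in> filtration B d"
      by (intro filtration_add v(2))
    then show ?thesis by (simp add: algebra_simps)
  qed
qed (auto simp: filtration_subspace filtration_K)

text \<open>This is the spanning half of the Poincare--Birkhoff--Witt theorem for restricted enveloping
  algebras, with all words of bounded length in place of the ordered monomials.\<close>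

theorem free_algebra_finite_dim_mod:
  "\<exists>E. finite E \<and> free_algebra.span (E \<union> K) = UNIV"
proof -
  define D where "D = card B * (CHAR('k) - 1)"
  have stable: "filtration B (D + n) \<subseteq> filtration B D" for n
  proof (induction n)
    case (Suc n)
    then show ?case using filtration_Suc_subset[of "D + n"] by (simp add: D_def)
  qed simp
  have "f \<in> filtration B D" for f
  proof (induction f rule: free_algebra_word_induct)
    case (word c xs)
    have "word xs \<in> filtration B (D + length xs)"
      using word_filtration[of xs] filtration_mono[of "length xs" "D + length xs" B] by auto
    then show ?case using stable by (intro filtration_scale) blast
  qed (rule filtration_add)
  moreover have "finite {u. set u \<subseteq> B \<and> length u \<le> D}"
    by (rule finite_lists_length_le[OF B])
  ultimately show ?thesis unfolding filtration_def by blast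
qed

end

end

section \<open>Semiperfect restricted enveloping algebras\<close>

theorem theorem2p7:
  fixes scale :: "'k::field \<Rightarrow> 'l::ab_group_add \<Rightarrow> 'l"
    and bracket :: "'l \<Rightarrow> 'l \<Rightarrow> 'l"
    and pmap :: "'l \<Rightarrow> 'l"
  assumes "restricted_lie_algebra scale bracket pmap"
    and "restricted_lie_algebra.locally_finite_dimensional scale bracket pmap"
    and "\<exists>I. restricted_lie_algebra.restricted_ideal scale bracket pmap I \<and>
             restricted_lie_algebra.p_nil pmap I \<and>
             restricted_lie_algebra.finite_codim scale I"
  shows "semiperfect_ring (restricted_lie_algebra.restricted_enveloping_algebra scale bracket pmap)"
proof -
  interpret restricted_lie_algebra scale bracket pmap by (rule assms(1))
  interpret F: ring "ring_of_type_algebra :: ('l, 'k) free_algebra ring"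
    by (rule ring_ring_of_type_algebra)
  obtain I where I: "restricted_ideal I" "p_nil I" "finite_codim I"
    using assms(3) by blast
  define K where "K = genideal (ring_of_type_algebra :: ('l, 'k) free_algebra ring) enveloping_relations"
  define N where "N = genideal (ring_of_type_algebra :: ('l, 'k) free_algebra ring) (K \<union> gen ` I)"
  \<comment> \<open>\<open>K\<close> presents \<open>u(L)\<close>, and \<open>N\<close> presents its quotient \<open>u(L/I)\<close>.\<close>
  have K: "ideal K ring_of_type_algebra" "enveloping_relations \<subseteq> K"
    unfolding K_def by (rule F.genideal_ideal F.genideal_self; simp)+
  have N: "ideal N ring_of_type_algebra" "K \<union> gen ` I \<subseteq> N"
    unfolding N_def by (rule F.genideal_ideal F.genideal_self; simp)+
  interpret uL: enveloping_ideal scale bracket pmap K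
    by (intro enveloping_ideal.intro enveloping_ideal_axioms.intro assms(1) K)
  interpret uLI: enveloping_ideal scale bracket pmap N
    using K N by (intro enveloping_ideal.intro enveloping_ideal_axioms.intro assms(1)) auto
  obtain B where B: "finite B" "\<And>x. \<exists>b\<in>span B. x - b \<in> I"
    using I(3) unfolding finite_codim_def by blast
  have "\<exists>b\<in>span B. gen (x - b) \<in> N" for x
    using B(2)[of x] N(2) by blast
  from uLI.free_algebra_finite_dim_mod[OF B(1) this]
  have "artinian_above N"
    using free_algebra_artinian_above by blast
  moreover have "\<exists>n. f ^ n \<in> K" if "f \<in> N" for f
    using uL.genideal_p_nil_ideal_nil[OF assms(2) I(1,2)] that by (simp add: N_def)
  ultimately show ?thesis
    unfolding restricted_enveloping_algebra_def K_def[symmetric]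
    using N by (intro semiperfect_Quot_if_nil_below_artinian[OF K(1) N(1)]) auto
qed

end
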